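(* Let $n\in\{0,1,2\}$, $\gamma>1$, and let $S=S(s)>0$ be a smooth function on an interval. Consider $$\varphi_{tt}+\varphi^{n(1-\gamma)}\varphi_s^{-\gamma}\Big(S'-n\gamma S\frac{\varphi_s}{\varphi}-\gamma S\frac{\varphi_{ss}}{\varphi_s}\Big)=0 .\qquad (\ast)$$ Then the Lie group classification of $(\ast)$ with respect to $S$ is as follows. (a) For every $S$, the equation admits $$X_1=\partial_t,\qquad X_2=((n+1)\gamma-n+1)\,t\partial_t+2\varphi\partial_\varphi;$$ if $n=0$ it additionally admits $\partial_\varphi$ and $t\partial_\varphi$; if $\gamma=\frac{n+3}{n+1}$ it additionally admits $t^2\partial_t+t\varphi\partial_\varphi$. For arbitrary (generic) $S$ these generators span the admitted Lie algebra of point symmetries. (b) The admitted Lie algebra is larger than the one spanned by the generators in (a) only if $S$ satisfies $(\alpha s+\beta)S'=qS$ for some constants $\alpha,\beta,q$ with $(\alpha,\beta)\neq(0,0)$; up to a translation of $s$ this gives exactly the three cases $S=A_0$, $S=A_0s^q$ $(q\ne0)$, $S=A_0e^{qs}$ $(q\neq0)$, where $A_0$ is a constant. In these cases the admitted Lie algebra is spanned by the generators in (a) together with the following additional generators: (i) $S=A_0$: $\ \partial_s$ and $(\gamma-1)t\partial_t-2s\partial_s$; (ii) $S=A_0s^q$, $q\neq0$: $\ (1-\gamma-q)t\partial_t+2s\partial_s$; (iii) $S=A_0e^{qs}$, $q\ne0$: $\ qt\partial_t-2\partial_s$.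
   Context: Equation $(\ast)$ is the gas dynamics equation of one-dimensional flows of a polytropic gas in mass Lagrangian coordinates $(t,s)$; $n=0,1,2$ corresponds to plane, radially symmetric and spherically symmetric flows. Here $\varphi_s>0$, and $\varphi>0$ when $n\ge1$. Point symmetries are vector fields $\xi^t(t,s,\varphi)\partial_t+\xi^s(t,s,\varphi)\partial_s+\eta^\varphi(t,s,\varphi)\partial_\varphi$ whose second prolongation annihilates the left-hand side of $(\ast)$ on the manifold in jet space defined by $(\ast)$. In the power case $s^q$ is understood on an interval where $s>0$ (or as $|s|^q$ on an interval with $s<0$). *)

theory Defs
  imports "HOL-Analysis.Analysis"
begin

section \<open>Smooth maps on open sets\<close>

primrec Ck_on :: "nat \<Rightarrow> 'a set \<Rightarrow> ('a::euclidean_space \<Rightarrow> 'b::real_normed_vector) \<Rightarrow> bool" where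
  "Ck_on 0 U f \<longleftrightarrow> continuous_on U f"
| "Ck_on (Suc k) U f \<longleftrightarrow>
     f differentiable_on U \<and> (\<forall>b\<in>Basis. Ck_on k U (\<lambda>x. frechet_derivative f (at x) b))"

text \<open>Only meant for open \<open>U\<close>, where the derivative at a point of \<open>U\<close> is determined by the
  values of the map on \<open>U\<close>.\<close>

definition smooth_on :: "'a set \<Rightarrow> ('a::euclidean_space \<Rightarrow> 'b::real_normed_vector) \<Rightarrow> bool" where
  "smooth_on U f \<longleftrightarrow> (\<forall>k. Ck_on k U f)"

definition open_interval :: "real set \<Rightarrow> bool" where
  "open_interval I \<longleftrightarrow> open I \<and> is_interval I \<and> I \<noteq> {}"


section \<open>Jets, total derivatives and the second prolongation\<close>

text \<open>A function on the second-order jet space takes the coordinates in the order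
  \<open>t s u u\<^sub>t u\<^sub>s u\<^sub>t\<^sub>t u\<^sub>t\<^sub>s u\<^sub>s\<^sub>s\<close>, where \<open>u\<close> stands for \<open>\<phi>\<close>.
  A vector field on the space of \<open>(t, s, u)\<close> is the map sending a point to its
  components \<open>(\<xi>\<^sup>t, \<xi>\<^sup>s, \<eta>)\<close>.\<close>

type_synonym jet_fun =
  "real \<Rightarrow> real \<Rightarrow> real \<Rightarrow> real \<Rightarrow> real \<Rightarrow> real \<Rightarrow> real \<Rightarrow> real \<Rightarrow> real"

type_synonym vfield = "real \<times> real \<times> real \<Rightarrow> real \<times> real \<times> real"

definition xi_t :: "vfield \<Rightarrow> jet_fun" where
  "xi_t X = (\<lambda>t s u ut us utt uts uss. fst (X (t, s, u)))"

definition xi_s :: "vfield \<Rightarrow> jet_fun" where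
  "xi_s X = (\<lambda>t s u ut us utt uts uss. fst (snd (X (t, s, u))))"

definition eta :: "vfield \<Rightarrow> jet_fun" where
  "eta X = (\<lambda>t s u ut us utt uts uss. snd (snd (X (t, s, u))))"

text \<open>The total derivatives are applied only to functions that do not depend on the
  second-order coordinates, so no third-order terms occur.\<close>

definition total_t :: "jet_fun \<Rightarrow> jet_fun" where
  "total_t F = (\<lambda>t s u ut us utt uts uss.
       deriv (\<lambda>x. F x s u ut us utt uts uss) t
     + ut * deriv (\<lambda>x. F t s x ut us utt uts uss) u
     + utt * deriv (\<lambda>x. F t s u x us utt uts uss) ut
     + uts * deriv (\<lambda>x. F t s u ut x utt uts uss) us)"

definition total_s :: "jet_fun \<Rightarrow> jet_fun" where
  "total_s F = (\<lambda>t s u ut us utt uts uss.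
       deriv (\<lambda>x. F t x u ut us utt uts uss) s
     + us * deriv (\<lambda>x. F t s x ut us utt uts uss) u
     + uts * deriv (\<lambda>x. F t s u x us utt uts uss) ut
     + uss * deriv (\<lambda>x. F t s u ut x utt uts uss) us)"

definition eta_t :: "vfield \<Rightarrow> jet_fun" where
  "eta_t X = (\<lambda>t s u ut us utt uts uss.
       total_t (eta X) t s u ut us utt uts uss
     - ut * total_t (xi_t X) t s u ut us utt uts uss
     - us * total_t (xi_s X) t s u ut us utt uts uss)"

definition eta_s :: "vfield \<Rightarrow> jet_fun" where
  "eta_s X = (\<lambda>t s u ut us utt uts uss.
       total_s (eta X) t s u ut us utt uts uss
     - ut * total_s (xi_t X) t s u ut us utt uts uss
     - us * total_s (xi_s X) t s u ut us utt uts uss)"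

definition eta_tt :: "vfield \<Rightarrow> jet_fun" where
  "eta_tt X = (\<lambda>t s u ut us utt uts uss.
       total_t (eta_t X) t s u ut us utt uts uss
     - utt * total_t (xi_t X) t s u ut us utt uts uss
     - uts * total_t (xi_s X) t s u ut us utt uts uss)"

definition eta_ts :: "vfield \<Rightarrow> jet_fun" where
  "eta_ts X = (\<lambda>t s u ut us utt uts uss.
       total_s (eta_t X) t s u ut us utt uts uss
     - utt * total_s (xi_t X) t s u ut us utt uts uss
     - uts * total_s (xi_s X) t s u ut us utt uts uss)"

definition eta_ss :: "vfield \<Rightarrow> jet_fun" where
  "eta_ss X = (\<lambda>t s u ut us utt uts uss.
       total_s (eta_s X) t s u ut us utt uts uss
     - uts * total_s (xi_t X) t s u ut us utt uts uss
     - uss * total_s (xi_s X) t s u ut us utt uts uss)"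

definition prolong2 :: "vfield \<Rightarrow> jet_fun \<Rightarrow> jet_fun" where
  "prolong2 X F = (\<lambda>t s u ut us utt uts uss.
       xi_t X t s u ut us utt uts uss * deriv (\<lambda>x. F x s u ut us utt uts uss) t
     + xi_s X t s u ut us utt uts uss * deriv (\<lambda>x. F t x u ut us utt uts uss) s
     + eta X t s u ut us utt uts uss * deriv (\<lambda>x. F t s x ut us utt uts uss) u
     + eta_t X t s u ut us utt uts uss * deriv (\<lambda>x. F t s u x us utt uts uss) ut
     + eta_s X t s u ut us utt uts uss * deriv (\<lambda>x. F t s u ut x utt uts uss) us
     + eta_tt X t s u ut us utt uts uss * deriv (\<lambda>x. F t s u ut us x uts uss) utt
     + eta_ts X t s u ut us utt uts uss * deriv (\<lambda>x. F t s u ut us utt x uss) uts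
     + eta_ss X t s u ut us utt uts uss * deriv (\<lambda>x. F t s u ut us utt uts x) uss)"


section \<open>The gas dynamics equation and its admitted Lie algebra\<close>

text \<open>The factor \<open>\<phi>\<close> to the power \<open>n (1 - \<gamma>)\<close> is written \<open>(u ^ n) powr (1 - \<gamma>)\<close>: for \<open>n = 0\<close>
  this is \<open>1\<close> for every real \<open>u\<close>, whereas \<open>u powr 0\<close> is \<open>0\<close> at \<open>u = 0\<close>.\<close>

definition gas_lhs :: "nat \<Rightarrow> real \<Rightarrow> (real \<Rightarrow> real) \<Rightarrow> jet_fun" where
  "gas_lhs n \<gamma> S = (\<lambda>t s u ut us utt uts uss.
     utt + (u ^ n) powr (1 - \<gamma>) * us powr (- \<gamma>) *
       (deriv S s - real n * \<gamma> * S s * (us / u) - \<gamma> * S s * (uss / us)))"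

text \<open>\<open>J\<close>, \<open>I\<close>, \<open>V\<close> are the open intervals over which \<open>t\<close>, \<open>s\<close>, \<open>\<phi>\<close> range.\<close>

definition admits :: "nat \<Rightarrow> real \<Rightarrow> (real \<Rightarrow> real) \<Rightarrow>
    real set \<Rightarrow> real set \<Rightarrow> real set \<Rightarrow> vfield \<Rightarrow> bool" where
  "admits n \<gamma> S J I V X \<longleftrightarrow>
     (\<forall>t\<in>J. \<forall>s\<in>I. \<forall>u\<in>V. \<forall>ut us utt uts uss.
        us > 0 \<and> gas_lhs n \<gamma> S t s u ut us utt uts uss = 0 \<longrightarrow>
        prolong2 X (gas_lhs n \<gamma> S) t s u ut us utt uts uss = 0)"

text \<open>Vector fields are total functions here, but membership in the two sets below depends
  only on their values on \<open>J \<times> I \<times> V\<close> and on \<open>D\<close>, respectively.\<close>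

definition admitted_algebra :: "nat \<Rightarrow> real \<Rightarrow> (real \<Rightarrow> real) \<Rightarrow>
    real set \<Rightarrow> real set \<Rightarrow> real set \<Rightarrow> vfield set" where
  "admitted_algebra n \<gamma> S J I V = {X. smooth_on (J \<times> I \<times> V) X \<and> admits n \<gamma> S J I V X}"

definition span_on :: "(real \<times> real \<times> real) set \<Rightarrow> vfield set \<Rightarrow> vfield set" where
  "span_on D G = {X. \<exists>c. \<forall>p\<in>D. X p = (\<Sum>Y\<in>G. c Y *\<^sub>R Y p)}"

definition common_generators :: "nat \<Rightarrow> real \<Rightarrow> vfield set" where
  "common_generators n \<gamma> =
     {\<lambda>(t, s, u). (1, 0, 0),
      \<lambda>(t, s, u). (((real n + 1) * \<gamma> - real n + 1) * t, 0, 2 * u)}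
     \<union> (if n = 0 then {\<lambda>(t, s, u). (0, 0, 1), \<lambda>(t, s, u). (0, 0, t)} else {})
     \<union> (if \<gamma> = (real n + 3) / (real n + 1) then {\<lambda>(t, s, u). (t\<^sup>2, 0, t * u)} else {})"


section \<open>The special forms of \<open>S\<close>\<close>

definition classifying_ode :: "real set \<Rightarrow> (real \<Rightarrow> real) \<Rightarrow> bool" where
  "classifying_ode I S \<longleftrightarrow>
     (\<exists>\<alpha> \<beta> q. (\<alpha>, \<beta>) \<noteq> (0, 0) \<and> (\<forall>s\<in>I. (\<alpha> * s + \<beta>) * deriv S s = q * S s))"

definition constant_form :: "real set \<Rightarrow> (real \<Rightarrow> real) \<Rightarrow> bool" where
  "constant_form I S \<longleftrightarrow> (\<exists>A0. \<forall>s\<in>I. S s = A0)"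

definition power_form :: "real set \<Rightarrow> (real \<Rightarrow> real) \<Rightarrow> real \<Rightarrow> bool" where
  "power_form I S q \<longleftrightarrow>
     (I \<subseteq> {0<..} \<or> I \<subseteq> {..<0}) \<and> (\<exists>A0. \<forall>s\<in>I. S s = A0 * \<bar>s\<bar> powr q)"

definition exp_form :: "real set \<Rightarrow> (real \<Rightarrow> real) \<Rightarrow> real \<Rightarrow> bool" where
  "exp_form I S q \<longleftrightarrow> (\<exists>A0. \<forall>s\<in>I. S s = A0 * exp (q * s))"

text \<open>Translation of \<open>s\<close> by \<open>a\<close>, for domains, functions of \<open>s\<close> and vector fields.\<close>

definition shift_set :: "real \<Rightarrow> real set \<Rightarrow> real set" where
  "shift_set a I = {s. s + a \<in> I}"

definition shift_fun :: "real \<Rightarrow> (real \<Rightarrow> real) \<Rightarrow> real \<Rightarrow> real" where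
  "shift_fun a S = (\<lambda>s. S (s + a))"

definition shift_vfield :: "real \<Rightarrow> vfield \<Rightarrow> vfield" where
  "shift_vfield a X = (\<lambda>(t, s, u). X (t, s + a, u))"

end

(* The determining equation is polynomial in the jet coordinates that remain free on the
   equation manifold, and in the powers of u_s, so it splits. The coefficient of u_ts gives
   xi^t = T(t) and xi^s = R(s); the coefficients of u_t and u_ss make eta independent of s and
   affine in u, and give R S'/S as a combination E of eta, eta_u, R' and T'. Comparing the
   derivative of E in s with the part free of u_ss leaves R'' = 0, so R = alpha s + beta, and
   (alpha s + beta) S' = k S because E is otherwise free of s. What remains is linear algebra:
   the admitted fields are polynomial with finitely many parameters, and S enters only through
   the triples (alpha, beta, k) for which this equation holds. *)

theory Submission
  imports Defs
begin

section \<open>Smooth maps\<close>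

text \<open>Since \<gamma> is an arbitrary real number, the determining equation is not polynomial
  in \<open>us\<close>: next to 1 it contains two consecutive real powers, first \<open>us\<close>
  to -\<gamma>-1 and -\<gamma>, later -\<gamma> and 1-\<gamma>. Sampling at 1, 2, 4 turns each power
  into a geometric progression, so independence is a Vandermonde system with three nodes, and
  \<gamma> > 1 keeps the nodes apart. R'' vanishes because the comparison cancels every multiple of
  S' and S'' and leaves R'' with the coefficient -S, whatever n and \<gamma> are. The exceptional
  generators come from one scalar relation between T', eta_u and eta/u. Its part linear in t allows
  the projective field only for \<gamma> = (n+3)/(n+1); its part in 1/u excludes the fields d/dphi
  and t d/dphi when n >= 1. Removing the multiple of X_2 fixed by the phi-weight leaves three
  numbers, the residual weight \<tau> of t together with \<alpha> and \<beta>. Each case of the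
  classification then compares two conditions on this triple.\<close>

lemma Ck_on_cong:
  assumes "open U" "\<And>x. x \<in> U \<Longrightarrow> f x = g x" "Ck_on k U f"
  shows "Ck_on k U g"
  using assms(2,3)
proof (induction k arbitrary: f g)
  case 0
  then show ?case by (simp cong: continuous_on_cong)
next
  case (Suc k)
  have eq: "frechet_derivative f (at x) = frechet_derivative g (at x)"
    and diff: "g differentiable at x" if x: "x \<in> U" for x
  proof -
    have "f differentiable at x"
      using Suc.prems(2) x \<open>open U\<close> by (simp add: differentiable_on_eq_differentiable_at)
    then have "(f has_derivative frechet_derivative f (at x)) (at x)"
      by (simp add: frechet_derivative_works)
    then have "(g has_derivative frechet_derivative f (at x)) (at x)"
      by (rule has_derivative_transform_within_open[OF _ \<open>open U\<close> x Suc.prems(1)])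
    then show "frechet_derivative f (at x) = frechet_derivative g (at x)" "g differentiable at x"
      by (auto simp: frechet_derivative_at differentiable_def)
  qed
  have "Ck_on k U (\<lambda>x. frechet_derivative g (at x) b)" if "b \<in> Basis" for b
    by (rule Suc.IH[of "\<lambda>x. frechet_derivative f (at x) b"]) (use Suc.prems eq that in auto)
  then show ?case
    using diff by (simp add: differentiable_on_def differentiable_at_withinI)
qed

lemma smooth_on_cong:
  assumes "open U" "\<And>x. x \<in> U \<Longrightarrow> f x = g x" "smooth_on U f"
  shows "smooth_on U g"
  using Ck_on_cong[OF assms(1,2)] assms(3) by (auto simp: smooth_on_def)

text \<open>A bounded linear map commutes with differentiation, so the induction stays inside maps
  of the form h o f. It is meant for the coordinate projections of a vector field.\<close>

lemma Ck_on_bounded_linear: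
  assumes "open U" "bounded_linear h" "Ck_on k U f"
  shows "Ck_on k U (\<lambda>x. h (f x))"
  using assms(3)
proof (induction k arbitrary: f)
  case 0
  then show ?case
    using bounded_linear.continuous_on[OF assms(2)] by auto
next
  case (Suc k)
  have D: "((\<lambda>x. h (f x)) has_derivative (\<lambda>y. h (frechet_derivative f (at x) y))) (at x)"
    if "x \<in> U" for x
  proof -
    have "f differentiable at x"
      using Suc.prems that \<open>open U\<close> by (simp add: differentiable_on_eq_differentiable_at)
    then show ?thesis
      using bounded_linear.has_derivative[OF assms(2)] by (simp add: frechet_derivative_works)
  qed
  have "Ck_on k U (\<lambda>x. frechet_derivative (\<lambda>x. h (f x)) (at x) b)" if "b \<in> Basis" for b
  proof (rule Ck_on_cong[OF \<open>open U\<close>])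
    show "Ck_on k U (\<lambda>x. h (frechet_derivative f (at x) b))"
      using Suc that by auto
    show "h (frechet_derivative f (at x) b) = frechet_derivative (\<lambda>x. h (f x)) (at x) b"
      if "x \<in> U" for x
      using frechet_derivative_at[OF D[OF that]] by metis
  qed
  moreover have "(\<lambda>x. h (f x)) differentiable_on U"
    using D \<open>open U\<close> by (auto simp: differentiable_on_eq_differentiable_at differentiable_def)
  ultimately show ?case by simp
qed

lemma smooth_on_bounded_linear:
  assumes "open U" "bounded_linear h" "smooth_on U f"
  shows "smooth_on U (\<lambda>x. h (f x))"
  using Ck_on_bounded_linear[OF assms(1,2)] assms(3) by (simp add: smooth_on_def)

lemma smooth_on_derivative:
  assumes "open U" "smooth_on U f"
  shows "x \<in> U \<Longrightarrow> (f has_derivative frechet_derivative f (at x)) (at x)"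
    and "b \<in> Basis \<Longrightarrow> smooth_on U (\<lambda>x. frechet_derivative f (at x) b)"
proof -
  have *: "Ck_on (Suc k) U f" for k
    using assms(2) unfolding smooth_on_def by blast
  show "x \<in> U \<Longrightarrow> (f has_derivative frechet_derivative f (at x)) (at x)"
    using *[of 0] \<open>open U\<close>
    by (simp add: differentiable_on_eq_differentiable_at frechet_derivative_works)
  show "b \<in> Basis \<Longrightarrow> smooth_on U (\<lambda>x. frechet_derivative f (at x) b)"
    using * by (simp add: smooth_on_def)
qed

text \<open>The derivative of a translate is the translate of the derivative, so the induction
  hypothesis applies to the directional derivatives. This carries S along a translation of
  s.\<close>

lemma smooth_on_translate:
  assumes "open U" "smooth_on U f"
  shows "smooth_on ((\<lambda>x. x + a) -` U) (\<lambda>x. f (x + a))"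
proof -
  let ?U = "(\<lambda>x. x + a) -` U"
  have U: "open ?U"
    by (intro open_vimage continuous_intros \<open>open U\<close>)
  have "Ck_on k ?U (\<lambda>x. f (x + a))" if "Ck_on k U f" for k
    using that
  proof (induction k arbitrary: f)
    case 0
    then show ?case
      by (auto intro!: continuous_on_compose2[of U f] continuous_intros)
  next
    case (Suc k)
    have D: "((\<lambda>x. f (x + a)) has_derivative frechet_derivative f (at (x + a))) (at x)"
      if "x \<in> ?U" for x
    proof -
      have "f differentiable at (x + a)"
        using Suc.prems that \<open>open U\<close> by (simp add: differentiable_on_eq_differentiable_at)
      then have f: "(f has_derivative frechet_derivative f (at (x + a))) (at (x + a))"
        by (simp add: frechet_derivative_works)
      have "((\<lambda>x. x + a) has_derivative (\<lambda>y. y)) (at x)"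
        by (auto intro!: derivative_eq_intros)
      from has_derivative_compose[OF this f] show ?thesis by simp
    qed
    have "Ck_on k ?U (\<lambda>x. frechet_derivative (\<lambda>x. f (x + a)) (at x) b)" if "b \<in> Basis" for b
    proof (rule Ck_on_cong[OF U])
      show "Ck_on k ?U (\<lambda>x. frechet_derivative f (at (x + a)) b)"
        using Suc.IH[of "\<lambda>x. frechet_derivative f (at x) b"] Suc.prems that by auto
      show "frechet_derivative f (at (x + a)) b = frechet_derivative (\<lambda>x. f (x + a)) (at x) b"
        if "x \<in> ?U" for x
        using frechet_derivative_at[OF D[OF that]] by metis
    qed
    moreover have "(\<lambda>x. f (x + a)) differentiable_on ?U"
      using D U by (auto simp: differentiable_on_eq_differentiable_at differentiable_def)
    ultimately show ?case by simp
  qed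
  with assms(2) show ?thesis by (simp add: smooth_on_def)
qed

section \<open>Polynomial maps are smooth\<close>

lemma real_polynomial_function_has_derivative:
  fixes f :: "'a::euclidean_space \<Rightarrow> real"
  assumes "real_polynomial_function f"
  shows "\<exists>f'. (\<forall>x. (f has_derivative f' x) (at x)) \<and>
    (\<forall>b. real_polynomial_function (\<lambda>x. f' x b))"
  using assms
proof induction
  case (linear f)
  then show ?case
    by (intro exI[of _ "\<lambda>_. f"])
      (auto simp: bounded_linear_imp_has_derivative real_polynomial_function.intros(2))
next
  case (const c)
  then show ?case
    by (intro exI[of _ "\<lambda>_ _. 0"]) (auto simp: real_polynomial_function.intros(2))
next
  case (add f g)
  then obtain f' g' where
    "\<And>x. (f has_derivative f' x) (at x)" "\<And>b. real_polynomial_function (\<lambda>x. f' x b)"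
    "\<And>x. (g has_derivative g' x) (at x)" "\<And>b. real_polynomial_function (\<lambda>x. g' x b)"
    by blast
  then show ?case
    by (intro exI[of _ "\<lambda>x y. f' x y + g' x y"])
      (auto intro!: derivative_intros real_polynomial_function.intros(3))
next
  case (mult f g)
  then obtain f' g' where
    "\<And>x. (f has_derivative f' x) (at x)" "\<And>b. real_polynomial_function (\<lambda>x. f' x b)"
    "\<And>x. (g has_derivative g' x) (at x)" "\<And>b. real_polynomial_function (\<lambda>x. g' x b)"
    by blast
  with mult.hyps show ?case
    by (intro exI[of _ "\<lambda>x y. f x * g' x y + f' x y * g x"])
      (auto intro!: has_derivative_mult real_polynomial_function.intros(3,4))
qed

lemma polynomial_function_has_derivative:
  fixes f :: "'a::euclidean_space \<Rightarrow> 'b::euclidean_space"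
  assumes "polynomial_function f"
  shows "\<exists>f'. (\<forall>x. (f has_derivative f' x) (at x)) \<and> (\<forall>b. polynomial_function (\<lambda>x. f' x b))"
proof -
  have "\<forall>i\<in>Basis. \<exists>f'. (\<forall>x. ((\<lambda>x. f x \<bullet> i) has_derivative f' x) (at x)) \<and>
      (\<forall>b. real_polynomial_function (\<lambda>x. f' x b))"
    using assms polynomial_function_iff_Basis_inner real_polynomial_function_has_derivative by blast
  then obtain f' where f': "\<And>i x. i \<in> Basis \<Longrightarrow> ((\<lambda>x. f x \<bullet> i) has_derivative f' i x) (at x)"
    "\<And>i b. i \<in> Basis \<Longrightarrow> real_polynomial_function (\<lambda>x. f' i x b)"
    by metis
  let ?f' = "\<lambda>x y. \<Sum>i\<in>Basis. f' i x y *\<^sub>R i"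
  have inner: "?f' x y \<bullet> i = f' i x y" if "i \<in> Basis" for x y i
    using that by (simp add: inner_sum_left inner_Basis if_distrib cong: if_cong)
  have "(f has_derivative ?f' x) (at x)" for x
    by (subst has_derivative_componentwise_within) (simp add: inner f'(1))
  moreover have "polynomial_function (\<lambda>x. ?f' x b)" for b
    using f'(2) by (subst polynomial_function_iff_Basis_inner) (simp add: inner)
  ultimately show ?thesis by (intro exI[of _ ?f']) simp
qed

lemma polynomial_function_smooth_on:
  fixes f :: "'a::euclidean_space \<Rightarrow> 'b::euclidean_space"
  assumes "polynomial_function f"
  shows "smooth_on U f"
proof -
  have "Ck_on k U f" for k
    using assms
  proof (induction k arbitrary: f)
    case 0
    then show ?case by (simp add: continuous_on_polymonial_function)
  next
    case (Suc k)
    from polynomial_function_has_derivative[OF Suc.prems] obtain f' where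
      f': "\<And>x. (f has_derivative f' x) (at x)" "\<And>b. polynomial_function (\<lambda>x. f' x b)"
      by blast
    have "frechet_derivative f (at x) = f' x" for x
      using frechet_derivative_at[OF f'(1)] by simp
    moreover have "f differentiable_on U"
      using f'(1) by (meson differentiable_at_imp_differentiable_on differentiable_def)
    ultimately show ?case
      using Suc.IH f'(2) by simp
  qed
  then show ?thesis by (simp add: smooth_on_def)
qed

text \<open>The partials are Frechet derivatives along the three basis vectors. They are smooth
  again, so the lemma can be applied to its own output to get second partials.\<close>

lemma smooth_on_partials:
  fixes f :: "real \<times> real \<times> real \<Rightarrow> real"
  assumes "open U" "smooth_on U f"
  obtains ft fs fu where "smooth_on U ft" "smooth_on U fs" "smooth_on U fu"
    "\<And>t s u. (t, s, u) \<in> U \<Longrightarrow> ((\<lambda>x. f (x, s, u)) has_real_derivative ft (t, s, u)) (at t)"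
    "\<And>t s u. (t, s, u) \<in> U \<Longrightarrow> ((\<lambda>x. f (t, x, u)) has_real_derivative fs (t, s, u)) (at s)"
    "\<And>t s u. (t, s, u) \<in> U \<Longrightarrow> ((\<lambda>x. f (t, s, x)) has_real_derivative fu (t, s, u)) (at u)"
proof -
  let ?d = "\<lambda>b p. frechet_derivative f (at p) b"
  have B: "(1, 0, 0) \<in> (Basis :: (real \<times> real \<times> real) set)"
    "(0, 1, 0) \<in> (Basis :: (real \<times> real \<times> real) set)"
    "(0, 0, 1) \<in> (Basis :: (real \<times> real \<times> real) set)"
    by (auto simp: Basis_prod_def zero_prod_def)
  \<comment> \<open>Chain rule along a curve g through the point with velocity b; below, g runs
    along a coordinate line.\<close>
  have D: "((\<lambda>x. f (g x)) has_real_derivative ?d b (g x0)) (at x0)"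
    if "g x0 \<in> U" "(g has_vector_derivative b) (at x0)" for g b and x0 :: real
  proof -
    have f: "(f has_derivative frechet_derivative f (at (g x0))) (at (g x0))"
      using smooth_on_derivative(1)[OF assms that(1)] .
    then interpret bounded_linear "frechet_derivative f (at (g x0))"
      by (rule has_derivative_bounded_linear)
    from has_derivative_compose[OF that(2)[unfolded has_vector_derivative_def] f]
    show ?thesis
      by (simp add: has_field_derivative_def scaleR mult_commute_abs)
  qed
  show thesis
  proof (rule that[of "?d (1, 0, 0)" "?d (0, 1, 0)" "?d (0, 0, 1)"])
    show "((\<lambda>x. f (x, s, u)) has_real_derivative ?d (1, 0, 0) (t, s, u)) (at t)"
      if "(t, s, u) \<in> U" for t s u
      by (rule D) (use that in \<open>auto intro!: has_vector_derivative_Pair has_vector_derivative_id has_vector_derivative_const\<close>)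
    show "((\<lambda>x. f (t, x, u)) has_real_derivative ?d (0, 1, 0) (t, s, u)) (at s)"
      if "(t, s, u) \<in> U" for t s u
      by (rule D) (use that in \<open>auto intro!: has_vector_derivative_Pair has_vector_derivative_id has_vector_derivative_const\<close>)
    show "((\<lambda>x. f (t, s, x)) has_real_derivative ?d (0, 0, 1) (t, s, u)) (at u)"
      if "(t, s, u) \<in> U" for t s u
      by (rule D) (use that in \<open>auto intro!: has_vector_derivative_Pair has_vector_derivative_id has_vector_derivative_const\<close>)
  qed (use smooth_on_derivative(2)[OF assms] B in auto)
qed

lemma smooth_on_real_derivative:
  fixes f :: "real \<Rightarrow> real"
  assumes "open U" "smooth_on U f"
  shows "x \<in> U \<Longrightarrow> (f has_real_derivative deriv f x) (at x)" and "smooth_on U (deriv f)"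
proof -
  have D: "(f has_real_derivative frechet_derivative f (at x) 1) (at x)" if "x \<in> U" for x
  proof -
    have f: "(f has_derivative frechet_derivative f (at x)) (at x)"
      using smooth_on_derivative(1)[OF assms that] .
    then interpret bounded_linear "frechet_derivative f (at x)"
      by (rule has_derivative_bounded_linear)
    have "frechet_derivative f (at x) = (*) (frechet_derivative f (at x) 1)"
    proof
      show "frechet_derivative f (at x) y = frechet_derivative f (at x) 1 * y" for y
        using scaleR[of y 1] by (simp add: mult.commute)
    qed
    then show ?thesis
      unfolding has_field_derivative_def by (rule has_derivative_eq_rhs[OF f])
  qed
  then show "x \<in> U \<Longrightarrow> (f has_real_derivative deriv f x) (at x)"
    using DERIV_imp_deriv by fastforce
  have "smooth_on U (\<lambda>x. frechet_derivative f (at x) 1)"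
    by (rule smooth_on_derivative(2)[OF assms]) simp
  then show "smooth_on U (deriv f)"
    by (rule smooth_on_cong[OF \<open>open U\<close>, rotated]) (use D DERIV_imp_deriv in fastforce)
qed

section \<open>The prolongation of a vector field\<close>

text \<open>\<open>deriv\<close> depends only on values near the point, so a component of a field
  may be replaced by a formula that is valid only on the box.\<close>

lemma deriv_eqI_open:
  assumes "open A" "x \<in> A" "\<And>y. y \<in> A \<Longrightarrow> f y = g y" "(g has_real_derivative d) (at x)"
  shows "deriv f x = d"
proof (rule DERIV_imp_deriv)
  show "(f has_real_derivative d) (at x)"
    using has_field_derivative_transform_within_open[OF assms(4) assms(1,2)] assms(3) by metis
qed

text \<open>No regularity of X is assumed: its components do not involve \<open>ut\<close> and
  \<open>us\<close>, so the second-order terms of the total derivatives are derivatives of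
  constants.\<close>

lemma eta_t_eq:
  "eta_t X t s u ut us utt uts uss =
     deriv (\<lambda>x. snd (snd (X (x, s, u)))) t + ut * deriv (\<lambda>x. snd (snd (X (t, s, x)))) u
   - ut * (deriv (\<lambda>x. fst (X (x, s, u))) t + ut * deriv (\<lambda>x. fst (X (t, s, x))) u)
   - us * (deriv (\<lambda>x. fst (snd (X (x, s, u)))) t + ut * deriv (\<lambda>x. fst (snd (X (t, s, x)))) u)"
  by (simp add: eta_t_def total_t_def eta_def xi_t_def xi_s_def)

lemma eta_s_eq:
  "eta_s X t s u ut us utt uts uss =
     deriv (\<lambda>x. snd (snd (X (t, x, u)))) s + us * deriv (\<lambda>x. snd (snd (X (t, s, x)))) u
   - ut * (deriv (\<lambda>x. fst (X (t, x, u))) s + us * deriv (\<lambda>x. fst (X (t, s, x))) u)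
   - us * (deriv (\<lambda>x. fst (snd (X (t, x, u)))) s + us * deriv (\<lambda>x. fst (snd (X (t, s, x)))) u)"
  by (simp add: eta_s_def total_s_def eta_def xi_t_def xi_s_def)

text \<open>\<open>uts\<close> enters twice, through the \<open>us\<close>-derivative of
  \<open>eta_t\<close> and through the explicit term with \<open>xi_s\<close>, each time with the
  same coefficient; hence the factor 2. The second derivatives of X sit in the value at
  \<open>uts = 0\<close> and never have to be computed.\<close>

lemma eta_tt_affine_in_uts:
  "eta_tt X t s u ut us utt uts uss = eta_tt X t s u ut us utt 0 uss
   - 2 * uts * (deriv (\<lambda>x. fst (snd (X (x, s, u)))) t + ut * deriv (\<lambda>x. fst (snd (X (t, s, x)))) u)"
proof -
  have D: "deriv (\<lambda>x. a - b - x * c) us = - c" for a b c us :: real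
    by (rule DERIV_imp_deriv) (auto intro!: derivative_eq_intros)
  show ?thesis
    by (simp add: eta_tt_def total_t_def[of "eta_t X"] eta_t_eq D)
      (simp add: total_t_def xi_t_def xi_s_def algebra_simps)
qed

lemma eta_ss_affine_in_uts:
  "eta_ss X t s u ut us utt uts uss = eta_ss X t s u ut us utt 0 uss
   - 2 * uts * (deriv (\<lambda>x. fst (X (t, x, u))) s + us * deriv (\<lambda>x. fst (X (t, s, x))) u)"
proof -
  have D: "deriv (\<lambda>x. a - x * b - c) ut = - b" for a b c ut :: real
    by (rule DERIV_imp_deriv) (auto intro!: derivative_eq_intros)
  show ?thesis
    by (simp add: eta_ss_def total_s_def[of "eta_s X"] eta_s_eq D)
      (simp add: total_s_def xi_t_def xi_s_def algebra_simps)
qed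

definition has_partials ::
  "real set \<Rightarrow> real set \<Rightarrow> real set \<Rightarrow> (real \<Rightarrow> real \<Rightarrow> real \<Rightarrow> real) \<Rightarrow>
   (real \<Rightarrow> real \<Rightarrow> real \<Rightarrow> real) \<Rightarrow> (real \<Rightarrow> real \<Rightarrow> real \<Rightarrow> real) \<Rightarrow>
   (real \<Rightarrow> real \<Rightarrow> real \<Rightarrow> real) \<Rightarrow> bool" where
  "has_partials J I V f ft fs fu \<longleftrightarrow> (\<forall>t\<in>J. \<forall>s\<in>I. \<forall>u\<in>V.
     ((\<lambda>x. f x s u) has_real_derivative ft t s u) (at t) \<and>
     ((\<lambda>x. f t x u) has_real_derivative fs t s u) (at s) \<and>
     ((\<lambda>x. f t s x) has_real_derivative fu t s u) (at u))"

lemma has_partialsD: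
  assumes "has_partials J I V f ft fs fu" "t \<in> J" "s \<in> I" "u \<in> V"
  shows "((\<lambda>x. f x s u) has_real_derivative ft t s u) (at t)"
    "((\<lambda>x. f t x u) has_real_derivative fs t s u) (at s)"
    "((\<lambda>x. f t s x) has_real_derivative fu t s u) (at u)"
  using assms by (auto simp: has_partials_def)

text \<open>Only fields with \<open>\<xi>\<^sup>t = T(t)\<close> and \<open>\<xi>\<^sup>s = R(s)\<close> survive the first splitting of the
  determining equation. \<open>Hab\<close> is the \<open>b\<close>-derivative of \<open>Ha\<close>, so \<open>Htu\<close> and \<open>Hut\<close> are kept apart;
  their equality is never needed.\<close>

locale fibred_vfield =
  fixes J I V :: "real set" and X :: vfield and T T1 T2 R R1 R2 :: "real \<Rightarrow> real"
    and H Ht Hs Hu Htt Hts Htu Hst Hss Hsu Hut Hus Huu :: "real \<Rightarrow> real \<Rightarrow> real \<Rightarrow> real"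
  assumes open_box: "open J" "open I" "open V"
    and X_eq: "\<And>t s u. t \<in> J \<Longrightarrow> s \<in> I \<Longrightarrow> u \<in> V \<Longrightarrow> X (t, s, u) = (T t, R s, H t s u)"
    and T1: "\<And>t. t \<in> J \<Longrightarrow> (T has_real_derivative T1 t) (at t)"
    and T2: "\<And>t. t \<in> J \<Longrightarrow> (T1 has_real_derivative T2 t) (at t)"
    and R1: "\<And>s. s \<in> I \<Longrightarrow> (R has_real_derivative R1 s) (at s)"
    and R2: "\<And>s. s \<in> I \<Longrightarrow> (R1 has_real_derivative R2 s) (at s)"
    and H: "has_partials J I V H Ht Hs Hu"
    and Ht: "has_partials J I V Ht Htt Hts Htu"
    and Hs: "has_partials J I V Hs Hst Hss Hsu"
    and Hu: "has_partials J I V Hu Hut Hus Huu"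
begin

lemmas H_partials = has_partialsD[OF H] has_partialsD[OF Ht] has_partialsD[OF Hs]
  has_partialsD[OF Hu]

lemma deriv_components:
  assumes "t \<in> J" "s \<in> I" "u \<in> V"
  shows "deriv (\<lambda>x. fst (X (x, s, u))) t = T1 t" "deriv (\<lambda>x. fst (X (t, x, u))) s = 0"
    "deriv (\<lambda>x. fst (X (t, s, x))) u = 0" "deriv (\<lambda>x. fst (snd (X (x, s, u)))) t = 0"
    "deriv (\<lambda>x. fst (snd (X (t, x, u)))) s = R1 s" "deriv (\<lambda>x. fst (snd (X (t, s, x)))) u = 0"
    "deriv (\<lambda>x. snd (snd (X (x, s, u)))) t = Ht t s u"
    "deriv (\<lambda>x. snd (snd (X (t, x, u)))) s = Hs t s u"
    "deriv (\<lambda>x. snd (snd (X (t, s, x)))) u = Hu t s u"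
  subgoal by (rule deriv_eqI_open[OF open_box(1) _ _ T1]) (simp_all add: assms X_eq)
  subgoal by (rule deriv_eqI_open[OF open_box(2) _ _ DERIV_const]) (simp_all add: assms X_eq)
  subgoal by (rule deriv_eqI_open[OF open_box(3) _ _ DERIV_const]) (simp_all add: assms X_eq)
  subgoal by (rule deriv_eqI_open[OF open_box(1) _ _ DERIV_const]) (simp_all add: assms X_eq)
  subgoal by (rule deriv_eqI_open[OF open_box(2) _ _ R1]) (simp_all add: assms X_eq)
  subgoal by (rule deriv_eqI_open[OF open_box(3) _ _ DERIV_const]) (simp_all add: assms X_eq)
  subgoal by (rule deriv_eqI_open[OF open_box(1) _ _ H_partials(1)]) (simp_all add: assms X_eq)
  subgoal by (rule deriv_eqI_open[OF open_box(2) _ _ H_partials(2)]) (simp_all add: assms X_eq)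
  subgoal by (rule deriv_eqI_open[OF open_box(3) _ _ H_partials(3)]) (simp_all add: assms X_eq)
  done

lemma eta_t_fibred:
  assumes "t \<in> J" "s \<in> I" "u \<in> V"
  shows "eta_t X t s u ut us utt uts uss = Ht t s u + ut * Hu t s u - ut * T1 t"
  by (simp add: eta_t_eq deriv_components[OF assms])

lemma eta_s_fibred:
  assumes "t \<in> J" "s \<in> I" "u \<in> V"
  shows "eta_s X t s u ut us utt uts uss = Hs t s u + us * Hu t s u - us * R1 s"
  by (simp add: eta_s_eq deriv_components[OF assms])

text \<open>As \<xi>^t depends on t alone and \<xi>^s on s alone, no terms in \<open>uts\<close> or
  \<open>ut * utt\<close> survive. After \<open>utt\<close> is eliminated, \<open>ut\<close>
  therefore occurs only as a polynomial of degree two.\<close>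

lemma eta_tt_fibred:
  assumes tsu: "t \<in> J" "s \<in> I" "u \<in> V"
  shows "eta_tt X t s u ut us utt uts uss =
    Htt t s u + ut * (Hut t s u + Htu t s u - T2 t) + ut\<^sup>2 * Huu t s u + utt * (Hu t s u - 2 * T1 t)"
proof -
  have t: "deriv (\<lambda>x. eta_t X x s u ut us utt uts uss) t = Htt t s u + ut * Hut t s u - ut * T2 t"
    by (rule deriv_eqI_open[OF open_box(1) tsu(1) eta_t_fibred])
      (auto intro!: derivative_eq_intros H_partials T2 tsu)
  have u: "deriv (\<lambda>x. eta_t X t s x ut us utt uts uss) u = Htu t s u + ut * Huu t s u"
    by (rule deriv_eqI_open[OF open_box(3) tsu(3) eta_t_fibred])
      (auto intro!: derivative_eq_intros H_partials tsu)
  have ut: "deriv (\<lambda>x. eta_t X t s u x us utt uts uss) ut = Hu t s u - T1 t"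
    by (rule DERIV_imp_deriv) (auto intro!: derivative_eq_intros simp: eta_t_fibred tsu)
  have us: "deriv (\<lambda>x. eta_t X t s u ut x utt uts uss) us = 0"
    by (simp add: eta_t_fibred tsu)
  show ?thesis
    unfolding eta_tt_def total_t_def[of "eta_t X"] t u ut us
    by (simp add: total_t_def xi_t_def xi_s_def deriv_components[OF tsu]
        algebra_simps power2_eq_square)
qed

lemma eta_ss_fibred:
  assumes tsu: "t \<in> J" "s \<in> I" "u \<in> V"
  shows "eta_ss X t s u ut us utt uts uss =
    Hss t s u + us * (Hus t s u + Hsu t s u - R2 s) + us\<^sup>2 * Huu t s u + uss * (Hu t s u - 2 * R1 s)"
proof -
  have s: "deriv (\<lambda>x. eta_s X t x u ut us utt uts uss) s = Hss t s u + us * Hus t s u - us * R2 s"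
    by (rule deriv_eqI_open[OF open_box(2) tsu(2) eta_s_fibred])
      (auto intro!: derivative_eq_intros H_partials R2 tsu)
  have u: "deriv (\<lambda>x. eta_s X t s x ut us utt uts uss) u = Hsu t s u + us * Huu t s u"
    by (rule deriv_eqI_open[OF open_box(3) tsu(3) eta_s_fibred])
      (auto intro!: derivative_eq_intros H_partials tsu)
  have ut: "deriv (\<lambda>x. eta_s X t s u x us utt uts uss) ut = 0"
    by (simp add: eta_s_fibred tsu)
  have us: "deriv (\<lambda>x. eta_s X t s u ut x utt uts uss) us = Hu t s u - R1 s"
    by (rule DERIV_imp_deriv) (auto intro!: derivative_eq_intros simp: eta_s_fibred tsu)
  show ?thesis
    unfolding eta_ss_def total_s_def[of "eta_s X"] s u ut us
    by (simp add: total_s_def xi_t_def xi_s_def deriv_components[OF tsu]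
        algebra_simps power2_eq_square)
qed

end

section \<open>The determining equations\<close>

locale gas_dynamics =
  fixes n :: nat and \<gamma> :: real and S :: "real \<Rightarrow> real" and J I V :: "real set"
  assumes gamma: "\<gamma> > 1"
    and J: "open_interval J" and I: "open_interval I" and V: "open_interval V"
    and V_pos: "n \<ge> 1 \<Longrightarrow> V \<subseteq> {0<..}"
    and S_smooth: "smooth_on I S" and S_pos: "\<And>s. s \<in> I \<Longrightarrow> S s > 0"
begin

lemma open_box: "open J" "open I" "open V" "open (J \<times> I \<times> V)"
  using J I V by (auto simp: open_interval_def open_Times)

abbreviation P :: "real \<Rightarrow> real" where
  "P u \<equiv> (u ^ n) powr (1 - \<gamma>)"

lemma P_pos: "u \<in> V \<Longrightarrow> P u > 0"
  using V_pos by (cases "n = 0") auto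

lemma S_derivs:
  assumes "s \<in> I"
  shows "(S has_real_derivative deriv S s) (at s)"
    "(deriv S has_real_derivative deriv (deriv S) s) (at s)"
  using smooth_on_real_derivative[OF open_box(2)] S_smooth assms by blast+

text \<open>For n >= 1 this is the logarithmic derivative of a power of u > 0. For n = 0 the point u
  may be zero or negative, but P is then constantly 1 and the factor \<open>real n\<close> makes the
  right-hand side 0 whatever 1/u is.\<close>

lemma DERIV_P:
  assumes "u \<in> V"
  shows "(P has_real_derivative real n * (1 - \<gamma>) / u * P u) (at u)"
proof (cases "n = 0")
  case False
  with V_pos assms have u: "u > 0" by auto
  have "(P has_real_derivative (1 - \<gamma>) * (u ^ n) powr (1 - \<gamma> - 1) * (real n * u ^ (n - 1))) (at u)"
    using u by (auto intro!: derivative_eq_intros)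
  moreover have "(1 - \<gamma>) * (u ^ n) powr (1 - \<gamma> - 1) * (real n * u ^ (n - 1)) =
      real n * (1 - \<gamma>) / u * P u"
  proof -
    have "(u ^ n) powr (1 - \<gamma> - 1) = P u / u ^ n"
      using u by (subst powr_diff) simp
    then show ?thesis
      using u False by (simp add: power_diff field_simps del: diff_diff_add)
  qed
  ultimately show ?thesis by simp
qed simp

lemma DERIV_n_over_u:
  assumes "u \<in> V"
  shows "((\<lambda>x. real n * b * c * (y / x)) has_real_derivative - real n * b * c * y / u\<^sup>2) (at u)"
proof (cases "n = 0")
  case False
  with V_pos assms have "u > 0" by auto
  then show ?thesis
    by (auto intro!: derivative_eq_intros simp: power2_eq_square)
qed simp

text \<open>The common factor \<open>P u * us powr (- \<gamma>)\<close> is kept in front of each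
  derivative that carries it, so that on the equation manifold the terms can be compared by powers
  of \<open>us\<close>.\<close>

lemma gas_lhs_derivs:
  assumes "s \<in> I" "u \<in> V" "us > 0"
  shows "deriv (\<lambda>x. gas_lhs n \<gamma> S x s u ut us utt uts uss) t = 0"
    and "deriv (\<lambda>x. gas_lhs n \<gamma> S t x u ut us utt uts uss) s =
      P u * us powr (- \<gamma>) * (deriv (deriv S) s - real n * \<gamma> * deriv S s * (us / u) -
        \<gamma> * deriv S s * (uss / us))"
    and "deriv (\<lambda>x. gas_lhs n \<gamma> S t s x ut us utt uts uss) u =
      P u * us powr (- \<gamma>) * (real n * (1 - \<gamma>) / u * (deriv S s - real n * \<gamma> * S s * (us / u) -
        \<gamma> * S s * (uss / us)) + real n * \<gamma> * S s * us / u\<^sup>2)"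
    and "deriv (\<lambda>x. gas_lhs n \<gamma> S t s u x us utt uts uss) ut = 0"
    and "deriv (\<lambda>x. gas_lhs n \<gamma> S t s u ut x utt uts uss) us =
      P u * us powr (- \<gamma>) * (- \<gamma> / us * (deriv S s - real n * \<gamma> * S s * (us / u) -
        \<gamma> * S s * (uss / us)) - real n * \<gamma> * S s / u + \<gamma> * S s * uss / us\<^sup>2)"
    and "deriv (\<lambda>x. gas_lhs n \<gamma> S t s u ut us x uts uss) utt = 1"
    and "deriv (\<lambda>x. gas_lhs n \<gamma> S t s u ut us utt x uss) uts = 0"
    and "deriv (\<lambda>x. gas_lhs n \<gamma> S t s u ut us utt uts x) uss =
      - \<gamma> * S s * P u * us powr (- \<gamma>) / us"
proof -
  have powr: "us powr (- \<gamma> - 1) = us powr (- \<gamma>) / us"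
    using assms by (simp add: powr_diff)
  show "deriv (\<lambda>x. gas_lhs n \<gamma> S t x u ut us utt uts uss) s =
      P u * us powr (- \<gamma>) * (deriv (deriv S) s - real n * \<gamma> * deriv S s * (us / u) -
        \<gamma> * deriv S s * (uss / us))"
  proof -
    have "((\<lambda>x. utt + K * (deriv S x - real n * \<gamma> * S x * y - \<gamma> * S x * z)) has_real_derivative
        K * (deriv (deriv S) s - real n * \<gamma> * deriv S s * y - \<gamma> * deriv S s * z)) (at s)"
      for K y z
      by (auto intro!: derivative_eq_intros S_derivs assms simp: algebra_simps)
    from DERIV_imp_deriv[OF this] show ?thesis
      unfolding gas_lhs_def .
  qed
  show "deriv (\<lambda>x. gas_lhs n \<gamma> S t s x ut us utt uts uss) u =
      P u * us powr (- \<gamma>) * (real n * (1 - \<gamma>) / u * (deriv S s - real n * \<gamma> * S s * (us / u) -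
        \<gamma> * S s * (uss / us)) + real n * \<gamma> * S s * us / u\<^sup>2)"
  proof -
    have "((\<lambda>x. utt + P x * us powr (- \<gamma>) * (deriv S s - real n * \<gamma> * S s * (us / x) -
        \<gamma> * S s * (uss / us))) has_real_derivative
      0 + (real n * (1 - \<gamma>) / u * P u * us powr (- \<gamma>) * (deriv S s - real n * \<gamma> * S s * (us / u) -
        \<gamma> * S s * (uss / us)) + (0 - (- real n * \<gamma> * S s * us / u\<^sup>2) - 0) * (P u * us powr (- \<gamma>)))) (at u)"
      by (intro DERIV_add DERIV_const DERIV_mult DERIV_cmult_right DERIV_P DERIV_diff
          DERIV_n_over_u assms)
    from DERIV_imp_deriv[OF this] show ?thesis
      unfolding gas_lhs_def
      by (rule trans) (simp add: divide_inverse power2_eq_square algebra_simps)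
  qed
  show "deriv (\<lambda>x. gas_lhs n \<gamma> S t s u ut x utt uts uss) us =
      P u * us powr (- \<gamma>) * (- \<gamma> / us * (deriv S s - real n * \<gamma> * S s * (us / u) -
        \<gamma> * S s * (uss / us)) - real n * \<gamma> * S s / u + \<gamma> * S s * uss / us\<^sup>2)"
  proof -
    have "((\<lambda>x. utt + P u * x powr (- \<gamma>) * (a - b * (x * w) - c * (uss / x))) has_real_derivative
        P u * us powr (- \<gamma>) * (- \<gamma> / us * (a - b * (us * w) - c * (uss / us)) - b * w +
          c * uss / us\<^sup>2)) (at us)" for a b c w
      using assms(3) by (auto intro!: derivative_eq_intros simp: powr power2_eq_square field_simps)
    from DERIV_imp_deriv[OF this] show ?thesis
      unfolding gas_lhs_def by (simp add: divide_inverse)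
  qed
  show "deriv (\<lambda>x. gas_lhs n \<gamma> S t s u ut us utt uts x) uss =
      - \<gamma> * S s * P u * us powr (- \<gamma>) / us"
  proof -
    have "((\<lambda>x. utt + K * (a - c * (x / us))) has_real_derivative - c * K / us) (at uss)" for K a c
      using assms(3) by (auto intro!: derivative_eq_intros)
    from DERIV_imp_deriv[OF this] show ?thesis
      unfolding gas_lhs_def by simp
  qed
  show "deriv (\<lambda>x. gas_lhs n \<gamma> S t s u ut us x uts uss) utt = 1"
    unfolding gas_lhs_def
    by (rule DERIV_imp_deriv) (auto intro!: derivative_eq_intros)
qed (simp_all add: gas_lhs_def)

end

text \<open>The matrix is the Vandermonde matrix with nodes 1, x, y. It replaces linear independence
  of real powers: values of a power at 1, 2, 4 are the powers 0, 1, 2 of one node.\<close>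

lemma vandermonde_three:
  fixes x y b c h :: real
  assumes "h + b + c = 0" "h + x * b + y * c = 0" "h + x\<^sup>2 * b + y\<^sup>2 * c = 0"
    and "x \<noteq> 1" "y \<noteq> 1" "x \<noteq> y"
  shows "h = 0" "b = 0" "c = 0"
proof -
  \<comment> \<open>Third equation minus (1 + x) times the second plus x times the first: h and b
    drop out.\<close>
  have "(y - x) * (y - 1) * c = 0"
    using assms(1-3) by algebra
  then show c: "c = 0" using assms by simp
  have "(x - 1) * b = 0"
    using assms(1,2) c by algebra
  then show b: "b = 0" using assms by simp
  show "h = 0" using assms(1) b c by simp
qed

text \<open>With a = 2 powr (-\<gamma>) the nodes used below are 1, a/2, a and 1, a, 2a. The bounds
  make them distinct; at \<gamma> = 1 the nodes 1 and 2a would collide.\<close>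

lemma two_powr_neg_bounds:
  fixes \<gamma> :: real
  assumes "\<gamma> > 1"
  shows "0 < 2 powr (- \<gamma>)" "2 powr (- \<gamma>) < 1 / 2" "4 powr (- \<gamma>) = (2 powr (- \<gamma>))\<^sup>2"
proof -
  show "0 < 2 powr (- \<gamma>)" by simp
  have "2 powr (- \<gamma>) < 2 powr (- 1)"
    using assms by (intro powr_less_mono) auto
  then show "2 powr (- \<gamma>) < 1 / 2" by (simp add: powr_minus)
  show "4 powr (- \<gamma>) = (2 powr (- \<gamma>))\<^sup>2"
    using powr_mult[of 2 2 "- \<gamma>"] by (simp add: power2_eq_square)
qed

lemma open_interval_constant:
  fixes f :: "real \<Rightarrow> real"
  assumes "open_interval A" "\<And>x. x \<in> A \<Longrightarrow> (f has_real_derivative 0) (at x)" "x \<in> A" "y \<in> A"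
  shows "f x = f y"
proof -
  have "convex A"
    using assms(1) by (simp add: open_interval_def is_interval_convex_1)
  then obtain c where "\<And>z. z \<in> A \<Longrightarrow> f z = c"
    using has_field_derivative_zero_constant[of A f] assms(2) has_field_derivative_at_within by metis
  then show ?thesis using assms by simp
qed

text \<open>The terms of the determining equation at one base point, with \<open>p = \<phi>\<^sub>s\<close>, \<open>w = 1 / \<phi>\<close> and
  \<open>\<phi>\<^sub>t\<^sub>t\<close> eliminated; the powers of \<open>\<phi>\<^sub>t\<close>, \<open>\<phi>\<^sub>s\<^sub>s\<close> and \<open>p\<close> are independent.\<close>

lemma split_determining_equation:
  fixes \<gamma> m w P S0 S1 S2 R R1 R2 H Hs Hu Htt K Huu Hss M T1 :: real
    and F :: "real \<Rightarrow> real \<Rightarrow> real \<Rightarrow> real"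
  assumes "\<gamma> > 1" "P > 0" "S0 > 0"
    and F: "\<And>ut p uss. p > 0 \<Longrightarrow> F ut p uss =
      R * (P * p powr (- \<gamma>) * (S2 - m * \<gamma> * S1 * (p * w) - \<gamma> * S1 * (uss / p)))
    + H * (P * p powr (- \<gamma>) * (m * (1 - \<gamma>) * w * (S1 - m * \<gamma> * S0 * (p * w) -
        \<gamma> * S0 * (uss / p)) + m * \<gamma> * S0 * p * w\<^sup>2))
    + (Hs + p * (Hu - R1)) * (P * p powr (- \<gamma>) * (- \<gamma> / p * (S1 - m * \<gamma> * S0 * (p * w) -
        \<gamma> * S0 * (uss / p)) - m * \<gamma> * S0 * w + \<gamma> * S0 * uss / p\<^sup>2))
    + (Htt + ut * K + ut\<^sup>2 * Huu - P * p powr (- \<gamma>) * (S1 - m * \<gamma> * S0 * (p * w) -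
        \<gamma> * S0 * (uss / p)) * (Hu - 2 * T1))
    + (Hss + p * M + p\<^sup>2 * Huu + uss * (Hu - 2 * R1)) * (- \<gamma> * S0 * P * p powr (- \<gamma>) / p)"
    and F_0: "\<And>ut p uss. p > 0 \<Longrightarrow> F ut p uss = 0"
  shows "Huu = 0" "K = 0" "Hs = 0"
    and "R * S1 + S0 * (m * (1 - \<gamma>) * w * H - (\<gamma> + 1) * Hu - (1 - \<gamma>) * R1 + 2 * T1) = 0"
    and "\<lbrakk>Hss = 0; M = - R2\<rbrakk> \<Longrightarrow> Htt = 0"
    and "\<lbrakk>Hss = 0; M = - R2\<rbrakk> \<Longrightarrow>
      R * S2 + S1 * (m * (1 - \<gamma>) * w * H - \<gamma> * (Hu - R1) - (Hu - 2 * T1)) + \<gamma> * S0 * R2 = 0"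
proof -
  define Q where "Q p = p powr (- \<gamma>)" for p :: real
  have Q: "Q p > 0" if "p > 0" for p using that by (simp add: Q_def)
  \<comment> \<open>Comparing \<open>ut\<close> = 1 and -1 with 0 isolates the quadratic and the
    linear coefficient in \<open>ut\<close>.\<close>
  have "F 1 1 0 - F 0 1 0 = K + Huu" "F (-1) 1 0 - F 0 1 0 = - K + Huu"
    by (simp_all add: F)
  then have "K + Huu = 0" "- K + Huu = 0"
    by (simp_all add: F_0)
  then show Huu: "Huu = 0" and K: "K = 0" by simp_all
  \<comment> \<open>Up to the nonzero factor -\<gamma> * P * Q p / p this is the coefficient of
    \<open>uss\<close>.\<close>
  define E where "E p = R * S1 + S0 * (m * (1 - \<gamma>) * w * H - (\<gamma> + 1) * (Hs / p + Hu) -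
    (1 - \<gamma>) * R1 + 2 * T1)" for p
  have E: "E p = 0" if "p > 0" for p
  proof -
    have "F 0 p 1 - F 0 p 0 = - (\<gamma> * P * Q p / p * E p)"
      using that unfolding F[OF that] E_def Q_def[symmetric]
      by (simp add: field_simps power2_eq_square)
    then have "\<gamma> * P * Q p / p * E p = 0"
      using that by (simp add: F_0)
    then show ?thesis using Q[OF that] that assms(1,2) by simp
  qed
  \<comment> \<open>\<open>Hs / p\<close> is the only part of \<open>E p\<close> that varies with
    p.\<close>
  have "S0 * (\<gamma> + 1) * Hs = 2 * (E 2 - E 1)"
    by (simp add: E_def algebra_simps)
  with E assms(1,3) show Hs: "Hs = 0" by simp
  show "R * S1 + S0 * (m * (1 - \<gamma>) * w * H - (\<gamma> + 1) * Hu - (1 - \<gamma>) * R1 + 2 * T1) = 0"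
    using E[of 1] by (simp add: E_def Hs)
  \<comment> \<open>These assumptions become available only after \<open>Hs = 0\<close> is known
    throughout the box, which is why the last two conclusions are conditional.\<close>
  assume *: "Hss = 0" "M = - R2"
  define B where "B = R * S2 + S1 * (m * (1 - \<gamma>) * w * H - \<gamma> * (Hu - R1) - (Hu - 2 * T1)) +
    \<gamma> * S0 * R2"
  define C where "C = - m * \<gamma> * w * R * S1 - H * (m\<^sup>2 * (1 - \<gamma>) * \<gamma> * S0 * w\<^sup>2) + H * m * \<gamma> * S0 * w\<^sup>2
    + (Hu - R1) * (\<gamma> - 1) * m * \<gamma> * S0 * w + m * \<gamma> * S0 * w * (Hu - 2 * T1)"
  \<comment> \<open>The part free of \<open>ut\<close> and \<open>uss\<close> consists of the powers
    0, -\<gamma> and 1-\<gamma> of p.\<close>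
  have "F 0 p 0 = Htt + Q p * (P * B) + p * Q p * (P * C)" if "p > 0" for p
    using that unfolding F[OF that] Q_def[symmetric] B_def C_def
    by (simp add: Hs Huu K * field_simps power2_eq_square)
  then have BC: "Htt + Q p * (P * B) + p * Q p * (P * C) = 0" if "p > 0" for p
    using F_0 that by metis
  let ?a = "2 powr (- \<gamma>)"
  note a = two_powr_neg_bounds[OF \<open>\<gamma> > 1\<close>]
  \<comment> \<open>From p = 1 to 2 to 4 the last two powers grow by the ratios a and 2a, so the
    nodes are 1, a, 2a.\<close>
  have "Htt + P * B + P * C = 0" "Htt + ?a * (P * B) + 2 * ?a * (P * C) = 0"
    "Htt + ?a\<^sup>2 * (P * B) + (2 * ?a)\<^sup>2 * (P * C) = 0"
    using BC[of 1] BC[of 2] BC[of 4] by (simp_all add: Q_def a power2_eq_square)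
  from vandermonde_three[OF this] a
  show "Htt = 0" "R * S2 + S1 * (m * (1 - \<gamma>) * w * H - \<gamma> * (Hu - R1) - (Hu - 2 * T1)) +
    \<gamma> * S0 * R2 = 0"
    using assms(1,2) by (auto simp: B_def)
qed

context gas_dynamics
begin

text \<open>The equation does not contain \<open>uts\<close>, so this coordinate is free on the
  manifold. The prolonged equation is affine in it, and the difference between \<open>uts\<close> =
  1 and 0 is the coefficient, in which only first derivatives of X occur.\<close>

lemma admits_base_derivs:
  assumes X: "admits n \<gamma> S J I V X" and tsu: "t \<in> J" "s \<in> I" "u \<in> V"
  shows "deriv (\<lambda>x. fst (X (t, x, u))) s = 0" "deriv (\<lambda>x. fst (X (t, s, x))) u = 0"
    "deriv (\<lambda>x. fst (snd (X (x, s, u)))) t = 0" "deriv (\<lambda>x. fst (snd (X (t, s, x)))) u = 0"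
proof -
  let ?ts = "deriv (\<lambda>x. fst (X (t, x, u))) s" and ?tu = "deriv (\<lambda>x. fst (X (t, s, x))) u"
    and ?st = "deriv (\<lambda>x. fst (snd (X (x, s, u)))) t"
    and ?su = "deriv (\<lambda>x. fst (snd (X (t, s, x)))) u"
  define K where "K = \<gamma> * S s * P u"
  have K: "K > 0" using gamma S_pos P_pos tsu by (simp add: K_def)
  have main: "?st + ut * ?su = K * us powr (- \<gamma>) * (?ts / us + ?tu)" if "us > 0" for ut us
  proof -
    \<comment> \<open>This value puts the jet with \<open>uss = 0\<close> on the equation manifold,
      for every \<open>uts\<close>.\<close>
    define utt where "utt = - (P u * us powr (- \<gamma>) *
       (deriv S s - real n * \<gamma> * S s * (us / u)))"
    have "gas_lhs n \<gamma> S t s u ut us utt uts 0 = 0" for uts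
      by (simp add: gas_lhs_def utt_def)
    then have "prolong2 X (gas_lhs n \<gamma> S) t s u ut us utt uts 0 = 0" for uts
      using X tsu that by (simp add: admits_def)
    moreover have "prolong2 X (gas_lhs n \<gamma> S) t s u ut us utt 1 0 =
        prolong2 X (gas_lhs n \<gamma> S) t s u ut us utt 0 0 - 2 * (?st + ut * ?su) +
        2 * (\<gamma> * S s * P u * us powr (- \<gamma>) / us) * (?ts + us * ?tu)"
      unfolding prolong2_def gas_lhs_derivs[OF tsu(2,3) that]
        eta_tt_affine_in_uts[of X t s u ut us utt 1] eta_ss_affine_in_uts[of X t s u ut us utt 1]
      using that
      by (simp add: eta_t_eq eta_s_eq eta_def xi_t_def xi_s_def algebra_simps add_divide_distrib)
    ultimately have "?st + ut * ?su = (\<gamma> * S s * P u * us powr (- \<gamma>) / us) * (?ts + us * ?tu)"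
      by simp
    then show ?thesis
      using that by (simp add: K_def field_simps)
  qed
  \<comment> \<open>The right-hand side of \<open>main\<close> is free of \<open>ut\<close>.\<close>
  show su: "?su = 0"
    using main[of 1 0] main[of 1 1] by simp
  let ?a = "2 powr (- \<gamma>)"
  note a = two_powr_neg_bounds[OF gamma]
  \<comment> \<open>With \<open>ut = 0\<close>, the powers 0, -\<gamma>-1 and -\<gamma> of
    \<open>us\<close> give the nodes 1, a/2, a.\<close>
  have "?st + - (K * ?ts) + - (K * ?tu) = 0"
    "?st + ?a / 2 * - (K * ?ts) + ?a * - (K * ?tu) = 0"
    "?st + (?a / 2)\<^sup>2 * - (K * ?ts) + ?a\<^sup>2 * - (K * ?tu) = 0"
    using main[of 1 0] main[of 2 0] main[of 4 0]
    by (simp_all add: a power2_eq_square algebra_simps)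
  from vandermonde_three[OF this] a K gamma show "?st = 0" "?ts = 0" "?tu = 0"
    by auto
qed

text \<open>The box is a product of intervals, so vanishing partials make \<xi>^t constant in s and
  u, and \<xi>^s constant in t and u, by moving one coordinate at a time. T and R arise by freezing
  those coordinates at a base point.\<close>

lemma admitted_fibred:
  assumes "X \<in> admitted_algebra n \<gamma> S J I V"
  obtains T T1 T2 R R1 R2 H Ht Hs Hu Htt Hts Htu Hst Hss Hsu Hut Hus Huu where
    "fibred_vfield J I V X T T1 T2 R R1 R2 H Ht Hs Hu Htt Hts Htu Hst Hss Hsu Hut Hus Huu"
proof -
  let ?D = "J \<times> I \<times> V"
  have smooth: "smooth_on ?D X" and adm: "admits n \<gamma> S J I V X"
    using assms by (auto simp: admitted_algebra_def)
  obtain t0 s0 u0 where o: "t0 \<in> J" "s0 \<in> I" "u0 \<in> V"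
    using J I V by (auto simp: open_interval_def)
  have comp: "smooth_on ?D (\<lambda>p. fst (X p))" "smooth_on ?D (\<lambda>p. fst (snd (X p)))"
    "smooth_on ?D (\<lambda>p. snd (snd (X p)))"
    by (rule smooth_on_bounded_linear[OF open_box(4) _ smooth];
        intro bounded_linear_fst_comp bounded_linear_snd_comp bounded_linear_fst bounded_linear_snd)+
  have diff: "\<exists>ft fs fu. smooth_on ?D ft \<and> smooth_on ?D fs \<and> smooth_on ?D fu \<and>
      has_partials J I V (\<lambda>t s u. f (t, s, u)) (\<lambda>t s u. ft (t, s, u)) (\<lambda>t s u. fs (t, s, u))
        (\<lambda>t s u. fu (t, s, u))"
    if "smooth_on ?D f" for f
    using smooth_on_partials[OF open_box(4) that] unfolding has_partials_def
    by (metis mem_Sigma_iff)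
  obtain Tt Ts Tu where T: "smooth_on ?D Tt" and T': "has_partials J I V (\<lambda>t s u. fst (X (t, s, u)))
      (\<lambda>t s u. Tt (t, s, u)) (\<lambda>t s u. Ts (t, s, u)) (\<lambda>t s u. Tu (t, s, u))"
    using diff[OF comp(1)] by blast
  obtain Ttt Tts Ttu where T'': "has_partials J I V (\<lambda>t s u. Tt (t, s, u))
      (\<lambda>t s u. Ttt (t, s, u)) (\<lambda>t s u. Tts (t, s, u)) (\<lambda>t s u. Ttu (t, s, u))"
    using diff[OF T] by blast
  obtain Rt Rs Ru where R: "smooth_on ?D Rs"
    and R': "has_partials J I V (\<lambda>t s u. fst (snd (X (t, s, u))))
      (\<lambda>t s u. Rt (t, s, u)) (\<lambda>t s u. Rs (t, s, u)) (\<lambda>t s u. Ru (t, s, u))"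
    using diff[OF comp(2)] by blast
  obtain Rst Rss Rsu where R'': "has_partials J I V (\<lambda>t s u. Rs (t, s, u))
      (\<lambda>t s u. Rst (t, s, u)) (\<lambda>t s u. Rss (t, s, u)) (\<lambda>t s u. Rsu (t, s, u))"
    using diff[OF R] by blast
  obtain Ht Hs Hu where H: "smooth_on ?D Ht" "smooth_on ?D Hs" "smooth_on ?D Hu"
    and H': "has_partials J I V (\<lambda>t s u. snd (snd (X (t, s, u))))
      (\<lambda>t s u. Ht (t, s, u)) (\<lambda>t s u. Hs (t, s, u)) (\<lambda>t s u. Hu (t, s, u))"
    using diff[OF comp(3)] by blast
  obtain Htt Hts Htu where Ht: "has_partials J I V (\<lambda>t s u. Ht (t, s, u))
      (\<lambda>t s u. Htt (t, s, u)) (\<lambda>t s u. Hts (t, s, u)) (\<lambda>t s u. Htu (t, s, u))"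
    using diff[OF H(1)] by blast
  obtain Hst Hss Hsu where Hs: "has_partials J I V (\<lambda>t s u. Hs (t, s, u))
      (\<lambda>t s u. Hst (t, s, u)) (\<lambda>t s u. Hss (t, s, u)) (\<lambda>t s u. Hsu (t, s, u))"
    using diff[OF H(2)] by blast
  obtain Hut Hus Huu where Hu: "has_partials J I V (\<lambda>t s u. Hu (t, s, u))
      (\<lambda>t s u. Hut (t, s, u)) (\<lambda>t s u. Hus (t, s, u)) (\<lambda>t s u. Huu (t, s, u))"
    using diff[OF H(3)] by blast
  note T_der = has_partialsD[OF T'] and R_der = has_partialsD[OF R']
  have "Ts (t, s, u) = 0" "Tu (t, s, u) = 0" "Rt (t, s, u) = 0" "Ru (t, s, u) = 0"
    if "t \<in> J" "s \<in> I" "u \<in> V" for t s u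
    using admits_base_derivs[OF adm that] DERIV_imp_deriv[OF T_der(2)[OF that]]
      DERIV_imp_deriv[OF T_der(3)[OF that]] DERIV_imp_deriv[OF R_der(1)[OF that]]
      DERIV_imp_deriv[OF R_der(3)[OF that]] by simp_all
  then have zero: "((\<lambda>x. fst (X (t, x, u))) has_real_derivative 0) (at s)"
    "((\<lambda>x. fst (X (t, s, x))) has_real_derivative 0) (at u)"
    "((\<lambda>x. fst (snd (X (x, s, u)))) has_real_derivative 0) (at t)"
    "((\<lambda>x. fst (snd (X (t, s, x)))) has_real_derivative 0) (at u)"
    if "t \<in> J" "s \<in> I" "u \<in> V" for t s u
    using T_der(2,3)[OF that] R_der(1,3)[OF that] that by simp_all
  have T0: "fst (X (t, s, u)) = fst (X (t, s0, u0))" if "t \<in> J" "s \<in> I" "u \<in> V" for t s u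
  proof -
    have "fst (X (t, s, u)) = fst (X (t, s0, u))"
      by (rule open_interval_constant[OF I]) (use zero that o in simp_all)
    also have "\<dots> = fst (X (t, s0, u0))"
      by (rule open_interval_constant[OF V]) (use zero that o in simp_all)
    finally show ?thesis .
  qed
  have R0: "fst (snd (X (t, s, u))) = fst (snd (X (t0, s, u0)))"
    if "t \<in> J" "s \<in> I" "u \<in> V" for t s u
  proof -
    have "fst (snd (X (t, s, u))) = fst (snd (X (t0, s, u)))"
      by (rule open_interval_constant[OF J]) (use zero that o in simp_all)
    also have "\<dots> = fst (snd (X (t0, s, u0)))"
      by (rule open_interval_constant[OF V]) (use zero that o in simp_all)
    finally show ?thesis .
  qed
  have "fibred_vfield J I V X (\<lambda>t. fst (X (t, s0, u0))) (\<lambda>t. Tt (t, s0, u0)) (\<lambda>t. Ttt (t, s0, u0))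
      (\<lambda>s. fst (snd (X (t0, s, u0)))) (\<lambda>s. Rs (t0, s, u0)) (\<lambda>s. Rss (t0, s, u0))
      (\<lambda>t s u. snd (snd (X (t, s, u)))) (\<lambda>t s u. Ht (t, s, u)) (\<lambda>t s u. Hs (t, s, u))
      (\<lambda>t s u. Hu (t, s, u)) (\<lambda>t s u. Htt (t, s, u)) (\<lambda>t s u. Hts (t, s, u))
      (\<lambda>t s u. Htu (t, s, u)) (\<lambda>t s u. Hst (t, s, u)) (\<lambda>t s u. Hss (t, s, u))
      (\<lambda>t s u. Hsu (t, s, u)) (\<lambda>t s u. Hut (t, s, u)) (\<lambda>t s u. Hus (t, s, u))
      (\<lambda>t s u. Huu (t, s, u))"
  proof (rule fibred_vfield.intro)
    show "X (t, s, u) = (fst (X (t, s0, u0)), fst (snd (X (t0, s, u0))), snd (snd (X (t, s, u))))"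
      if "t \<in> J" "s \<in> I" "u \<in> V" for t s u
      using T0[OF that] R0[OF that] by (simp add: prod_eq_iff)
    show "((\<lambda>t. fst (X (t, s0, u0))) has_real_derivative Tt (t, s0, u0)) (at t)"
      "((\<lambda>t. Tt (t, s0, u0)) has_real_derivative Ttt (t, s0, u0)) (at t)" if "t \<in> J" for t
      using T_der(1)[OF that o(2,3)] has_partialsD(1)[OF T'' that o(2,3)] by blast+
    show "((\<lambda>s. fst (snd (X (t0, s, u0)))) has_real_derivative Rs (t0, s, u0)) (at s)"
      "((\<lambda>s. Rs (t0, s, u0)) has_real_derivative Rss (t0, s, u0)) (at s)" if "s \<in> I" for s
      using R_der(2)[OF o(1) that o(3)] has_partialsD(2)[OF R'' o(1) that o(3)] by blast+
  qed (rule H' Ht Hs Hu open_box)+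
  then show thesis by (rule that)
qed

text \<open>The unsimplified right-hand side matches the hypothesis on \<open>F\<close> in
  \<open>split_determining_equation\<close> literally, with m = n, w = 1/u, \<open>K\<close> = Hut +
  Htu - T2 and \<open>M\<close> = Hus + Hsu - R2.\<close>

lemma prolong2_fibred:
  assumes fv: "fibred_vfield J I V X T T1 T2 R R1 R2 H Ht Hs Hu Htt Hts Htu Hst Hss Hsu Hut Hus Huu"
    and tsu: "t \<in> J" "s \<in> I" "u \<in> V" and p: "p > 0"
    and gas: "gas_lhs n \<gamma> S t s u ut p utt uts uss = 0"
  shows "prolong2 X (gas_lhs n \<gamma> S) t s u ut p utt uts uss =
      R s * (P u * p powr (- \<gamma>) * (deriv (deriv S) s - real n * \<gamma> * deriv S s * (p * (1 / u)) -
        \<gamma> * deriv S s * (uss / p)))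
    + H t s u * (P u * p powr (- \<gamma>) * (real n * (1 - \<gamma>) * (1 / u) * (deriv S s -
        real n * \<gamma> * S s * (p * (1 / u)) - \<gamma> * S s * (uss / p)) + real n * \<gamma> * S s * p * (1 / u)\<^sup>2))
    + (Hs t s u + p * (Hu t s u - R1 s)) * (P u * p powr (- \<gamma>) * (- \<gamma> / p * (deriv S s -
        real n * \<gamma> * S s * (p * (1 / u)) - \<gamma> * S s * (uss / p)) -
        real n * \<gamma> * S s * (1 / u) + \<gamma> * S s * uss / p\<^sup>2))
    + (Htt t s u + ut * (Hut t s u + Htu t s u - T2 t) + ut\<^sup>2 * Huu t s u -
        P u * p powr (- \<gamma>) * (deriv S s - real n * \<gamma> * S s * (p * (1 / u)) -
        \<gamma> * S s * (uss / p)) * (Hu t s u - 2 * T1 t))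
    + (Hss t s u + p * (Hus t s u + Hsu t s u - R2 s) + p\<^sup>2 * Huu t s u +
        uss * (Hu t s u - 2 * R1 s)) * (- \<gamma> * S s * P u * p powr (- \<gamma>) / p)"
proof -
  note eqs = fibred_vfield.eta_t_fibred[OF fv tsu] fibred_vfield.eta_s_fibred[OF fv tsu]
    fibred_vfield.eta_tt_fibred[OF fv tsu] fibred_vfield.eta_ss_fibred[OF fv tsu]
    fibred_vfield.X_eq[OF fv tsu]
  have utt: "utt = - (P u * p powr (- \<gamma>) * (deriv S s - real n * \<gamma> * S s * (p * (1 / u)) -
        \<gamma> * S s * (uss / p)))"
    using gas by (simp add: gas_lhs_def)
  show ?thesis
    unfolding prolong2_def gas_lhs_derivs[OF tsu(2,3) p] eqs
    by (simp add: eqs utt eta_def xi_t_def xi_s_def power_one_over) (simp add: algebra_simps)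
qed

lemma determining_equations:
  assumes fv: "fibred_vfield J I V X T T1 T2 R R1 R2 H Ht Hs Hu Htt Hts Htu Hst Hss Hsu Hut Hus Huu"
    and X: "admits n \<gamma> S J I V X" and tsu: "t \<in> J" "s \<in> I" "u \<in> V"
  shows "Huu t s u = 0" "Hut t s u + Htu t s u = T2 t" "Hs t s u = 0"
    and "R s * deriv S s + S s * (real n * (1 - \<gamma>) * (1 / u) * H t s u - (\<gamma> + 1) * Hu t s u -
      (1 - \<gamma>) * R1 s + 2 * T1 t) = 0"
    and "\<lbrakk>Hss t s u = 0; Hus t s u = 0; Hsu t s u = 0\<rbrakk> \<Longrightarrow> Htt t s u = 0"
    and "\<lbrakk>Hss t s u = 0; Hus t s u = 0; Hsu t s u = 0\<rbrakk> \<Longrightarrow>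
      R s * deriv (deriv S) s + deriv S s * (real n * (1 - \<gamma>) * (1 / u) * H t s u -
        \<gamma> * (Hu t s u - R1 s) - (Hu t s u - 2 * T1 t)) + \<gamma> * S s * R2 s = 0"
proof -
  define utt where "utt p uss = - (P u * p powr (- \<gamma>) * (deriv S s -
      real n * \<gamma> * S s * (p / u) - \<gamma> * S s * (uss / p)))" for p uss
  have gas: "gas_lhs n \<gamma> S t s u ut p (utt p uss) 0 uss = 0" for ut p uss
    by (simp add: gas_lhs_def utt_def)
  then have prolong: "prolong2 X (gas_lhs n \<gamma> S) t s u ut p (utt p uss) 0 uss = 0"
    if "p > 0" for ut p uss
    using X tsu that by (simp add: admits_def)
  note split = split_determining_equation[OF gamma P_pos[OF tsu(3)] S_pos[OF tsu(2)]
      prolong2_fibred[OF fv tsu _ gas] prolong]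
  show "Huu t s u = 0" "Hut t s u + Htu t s u = T2 t" "Hs t s u = 0"
    "R s * deriv S s + S s * (real n * (1 - \<gamma>) * (1 / u) * H t s u - (\<gamma> + 1) * Hu t s u -
      (1 - \<gamma>) * R1 s + 2 * T1 t) = 0"
    using split(1-4) by simp_all
  assume "Hss t s u = 0" "Hus t s u = 0" "Hsu t s u = 0"
  then show "Htt t s u = 0" "R s * deriv (deriv S) s +
      deriv S s * (real n * (1 - \<gamma>) * (1 / u) * H t s u -
        \<gamma> * (Hu t s u - R1 s) - (Hu t s u - 2 * T1 t)) + \<gamma> * S s * R2 s = 0"
    \<comment> \<open>\<open>R2\<close> does not occur in the formula for \<open>F\<close>, so
      unification cannot determine it.\<close>
    using split(5,6)[where ?R2.0 = "R2 s"] by simp_all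
qed

end

section \<open>Solving the determining equations\<close>

lemma open_interval_two_points:
  assumes "open_interval A"
  obtains x y where "x \<in> A" "y \<in> A" "x \<noteq> y"
proof -
  obtain x where x: "x \<in> A" using assms by (auto simp: open_interval_def)
  then obtain e where e: "e > 0" "ball x e \<subseteq> A"
    using assms by (auto simp: open_interval_def open_contains_ball)
  then have "x + e / 2 \<in> A" by (auto simp: dist_real_def)
  with x e(1) that[of x "x + e / 2"] show thesis by simp
qed

lemma open_interval_affine:
  fixes f f' :: "real \<Rightarrow> real"
  assumes A: "open_interval A" and "\<And>x. x \<in> A \<Longrightarrow> (f has_real_derivative f' x) (at x)"
    and "\<And>x. x \<in> A \<Longrightarrow> (f' has_real_derivative 0) (at x)"
  shows "\<exists>a b. (\<forall>x\<in>A. f x = a + b * x) \<and> (\<forall>x\<in>A. f' x = b)"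
proof -
  obtain x0 where x0: "x0 \<in> A" using A by (auto simp: open_interval_def)
  have f': "f' x = f' x0" if "x \<in> A" for x
    using open_interval_constant[OF A assms(3) that x0] by simp
  have "((\<lambda>x. f x - f' x0 * x) has_real_derivative 0) (at x)" if "x \<in> A" for x
    using assms(2)[OF that] f'[OF that] by (auto intro!: derivative_eq_intros)
  then have "f x - f' x0 * x = f x0 - f' x0 * x0" if "x \<in> A" for x
    by (rule open_interval_constant[OF A _ that x0])
  then have "f x = (f x0 - f' x0 * x0) + f' x0 * x" if "x \<in> A" for x
    using that by (simp add: algebra_simps)
  with f' show ?thesis by blast
qed

text \<open>A function affine in u is the interpolation of its values at two points x and y. These
  values are affine in t, so the interpolation formula gives coefficients affine in t, although
  nothing was known about how they depend on t.\<close>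

lemma affine_in_each_variable:
  fixes h :: "real \<Rightarrow> real \<Rightarrow> real"
  assumes V: "open_interval V"
    and "\<And>t. t \<in> J \<Longrightarrow> \<exists>a b. \<forall>u\<in>V. h t u = a + b * u"
    and "\<And>u. u \<in> V \<Longrightarrow> \<exists>a b. \<forall>t\<in>J. h t u = a + b * t"
  shows "\<exists>e0 e1 e2 e3. \<forall>t\<in>J. \<forall>u\<in>V. h t u = e0 + e1 * t + (e2 + e3 * t) * u"
proof -
  obtain x y where xy: "x \<in> V" "y \<in> V" "x \<noteq> y"
    using open_interval_two_points[OF V] .
  obtain a b where x: "\<And>t. t \<in> J \<Longrightarrow> h t x = a + b * t" using assms(3)[OF xy(1)] by blast
  obtain c d where y: "\<And>t. t \<in> J \<Longrightarrow> h t y = c + d * t" using assms(3)[OF xy(2)] by blast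
  have "h t u = (a - (c - a) / (y - x) * x) + (b - (d - b) / (y - x) * x) * t +
      ((c - a) / (y - x) + (d - b) / (y - x) * t) * u" if tu: "t \<in> J" "u \<in> V" for t u
  proof -
    obtain p q where pq: "\<And>u. u \<in> V \<Longrightarrow> h t u = p + q * u" using assms(2)[OF tu(1)] by blast
    have "p + q * x = a + b * t" "p + q * y = c + d * t"
      using pq xy x y tu by metis+
    then have "q * (y - x) = (c - a) + (d - b) * t" and p: "p = a + b * t - q * x"
      by algebra+
    then have "q = ((c - a) + (d - b) * t) / (y - x)"
      using xy(3) by (simp add: eq_divide_eq)
    then have q: "q = (c - a) / (y - x) + (d - b) / (y - x) * t"
      by (simp add: add_divide_distrib)
    show ?thesis
      unfolding pq[OF tu(2)] p q by (simp add: algebra_simps)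
  qed
  then show ?thesis by blast
qed

text \<open>The coefficient \<open>e3\<close> is shared by t^2 in \<xi>^t and t * u in eta because
  the splitting in \<open>ut\<close> forces twice the mixed derivative of eta to equal T''.\<close>

definition affine_vfield ::
  "real \<Rightarrow> real \<Rightarrow> real \<Rightarrow> real \<Rightarrow> real \<Rightarrow> real \<Rightarrow> real \<Rightarrow> real \<Rightarrow> vfield" where
  "affine_vfield t0 t1 e0 e1 e2 e3 \<alpha> \<beta> = (\<lambda>(t, s, u).
     (t0 + t1 * t + e3 * t\<^sup>2, \<alpha> * s + \<beta>, e0 + e1 * t + (e2 + e3 * t) * u))"

lemma smooth_on_affine_vfield: "smooth_on U (affine_vfield t0 t1 e0 e1 e2 e3 \<alpha> \<beta>)"
proof (rule polynomial_function_smooth_on)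
  have lin: "real_polynomial_function (\<lambda>p :: real \<times> real \<times> real. fst p)"
    "real_polynomial_function (\<lambda>p :: real \<times> real \<times> real. fst (snd p))"
    "real_polynomial_function (\<lambda>p :: real \<times> real \<times> real. snd (snd p))"
    by (auto intro!: real_polynomial_function.intros(1) bounded_linear_fst_comp bounded_linear_snd_comp
        bounded_linear_fst bounded_linear_snd)
  have "polynomial_function (\<lambda>p.
      (t0 + t1 * fst p + e3 * (fst p)\<^sup>2) *\<^sub>R (1, 0, 0) + (\<alpha> * fst (snd p) + \<beta>) *\<^sub>R (0, 1, 0) +
      (e0 + e1 * fst p + (e2 + e3 * fst p) * snd (snd p)) *\<^sub>R (0 :: real, 0 :: real, 1 :: real))"
    by (intro polynomial_function_add polynomial_function_mult polynomial_function_const)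
      (auto simp: real_polynomial_function_eq[symmetric] intro!: lin real_polynomial_function.intros(2-4))
  then show "polynomial_function (affine_vfield t0 t1 e0 e1 e2 e3 \<alpha> \<beta>)"
    by (simp add: affine_vfield_def case_prod_unfold)
qed

text \<open>Here \<open>p = \<phi>\<^sub>s\<close>, \<open>w = 1 / \<phi>\<close>, and \<open>b\<close> is the coefficient of \<open>\<phi>\<close> in \<open>\<eta> = H\<close>.\<close>

lemma determining_equation_holds:
  fixes \<gamma> m w Q p uss S0 S1 S2 R \<alpha> k b H T1 :: real
  assumes "p > 0" "R * S1 = k * S0" "R * S2 = (k - \<alpha>) * S1" "m * (w * H) = m * b"
    and "2 * T1 = (1 - \<gamma>) * \<alpha> - k + ((m + 1) * \<gamma> - m + 1) * b"
  shows "R * (Q * (S2 - m * \<gamma> * S1 * (p * w) - \<gamma> * S1 * (uss / p)))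
    + H * (Q * (m * (1 - \<gamma>) * w * (S1 - m * \<gamma> * S0 * (p * w) -
        \<gamma> * S0 * (uss / p)) + m * \<gamma> * S0 * p * w\<^sup>2))
    + p * (b - \<alpha>) * (Q * (- \<gamma> / p * (S1 - m * \<gamma> * S0 * (p * w) -
        \<gamma> * S0 * (uss / p)) - m * \<gamma> * S0 * w + \<gamma> * S0 * uss / p\<^sup>2))
    - Q * (S1 - m * \<gamma> * S0 * (p * w) - \<gamma> * S0 * (uss / p)) * (b - 2 * T1)
    + uss * (b - 2 * \<alpha>) * (- \<gamma> * S0 * Q / p) = 0"
proof -
  define v where "v = uss / p"
  \<comment> \<open>\<open>G\<close> is the bracket of the equation. The summands become Q times
    combinations of \<open>G\<close>, \<open>S1\<close>, \<open>S0 * (p * w)\<close> and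
    \<open>S0 * v\<close>. Rewriting S1 through \<open>G\<close>, the coefficients vanish one by
    one; the assumption on \<open>T1\<close> is the one belonging to \<open>G\<close>.\<close>
  define G where "G = S1 - m * \<gamma> * S0 * (p * w) - \<gamma> * S0 * v"
  have "R * (Q * (S2 - m * \<gamma> * S1 * (p * w) - \<gamma> * S1 * v)) =
      Q * (R * S2 - m * \<gamma> * (R * S1) * (p * w) - \<gamma> * (R * S1) * v)"
    by (simp add: algebra_simps)
  also have "\<dots> = Q * (k * G - \<alpha> * S1)"
    unfolding assms(2,3) G_def by (simp add: algebra_simps)
  finally have 1: "R * (Q * (S2 - m * \<gamma> * S1 * (p * w) - \<gamma> * S1 * v)) = Q * (k * G - \<alpha> * S1)" .
  have "H * (Q * (m * (1 - \<gamma>) * w * G + m * \<gamma> * S0 * p * w\<^sup>2)) =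
      Q * (m * (w * H)) * ((1 - \<gamma>) * G + \<gamma> * S0 * (p * w))"
    by (simp add: algebra_simps power2_eq_square)
  also have "\<dots> = Q * (m * b) * ((1 - \<gamma>) * G + \<gamma> * S0 * (p * w))"
    by (simp add: assms(4))
  finally have 2: "H * (Q * (m * (1 - \<gamma>) * w * G + m * \<gamma> * S0 * p * w\<^sup>2)) =
      Q * (m * b) * ((1 - \<gamma>) * G + \<gamma> * S0 * (p * w))" .
  have 3: "p * (b - \<alpha>) * (Q * (- \<gamma> / p * G - m * \<gamma> * S0 * w + \<gamma> * S0 * uss / p\<^sup>2)) =
      Q * (b - \<alpha>) * (- \<gamma> * G - m * \<gamma> * S0 * (p * w) + \<gamma> * S0 * v)"
    using assms(1) by (simp add: v_def field_simps power2_eq_square)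
  have 4: "uss * (b - 2 * \<alpha>) * (- \<gamma> * S0 * Q / p) = Q * (b - 2 * \<alpha>) * (- \<gamma> * S0 * v)"
    by (simp add: v_def)
  show ?thesis
    unfolding v_def[symmetric] G_def[symmetric] 1 2 3 4 assms(5)
    by (simp add: G_def algebra_simps)
qed

section \<open>Affine fields as the solutions of the determining equations\<close>

context gas_dynamics
begin

text \<open>T stays arbitrary because \<open>admitted_affine\<close> uses this representation before
  T is known: the determining equations for it yield T'' = 2 * e3.\<close>

lemma fibred_affine:
  assumes "\<And>t s u. t \<in> J \<Longrightarrow> s \<in> I \<Longrightarrow> u \<in> V \<Longrightarrow>
      X (t, s, u) = (T t, \<alpha> * s + \<beta>, e0 + e1 * t + (e2 + e3 * t) * u)"
    and "\<And>t. t \<in> J \<Longrightarrow> (T has_real_derivative T1 t) (at t)"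
    and "\<And>t. t \<in> J \<Longrightarrow> (T1 has_real_derivative T2 t) (at t)"
  shows "fibred_vfield J I V X T T1 T2 (\<lambda>s. \<alpha> * s + \<beta>) (\<lambda>_. \<alpha>) (\<lambda>_. 0)
      (\<lambda>t s u. e0 + e1 * t + (e2 + e3 * t) * u) (\<lambda>t s u. e1 + e3 * u) (\<lambda>t s u. 0)
      (\<lambda>t s u. e2 + e3 * t) (\<lambda>t s u. 0) (\<lambda>t s u. 0) (\<lambda>t s u. e3) (\<lambda>t s u. 0) (\<lambda>t s u. 0)
      (\<lambda>t s u. 0) (\<lambda>t s u. e3) (\<lambda>t s u. 0) (\<lambda>t s u. 0)"
  by (rule fibred_vfield.intro)
    (use open_box assms in \<open>auto simp: has_partials_def intro!: derivative_eq_intros\<close>)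

text \<open>Besides eliminating S'', the differentiated equation controls S' at a zero of \<alpha> *
  s + \<beta>, where the original equation leaves it open.\<close>

lemma DERIV_classifying_ode:
  assumes "\<And>s. s \<in> I \<Longrightarrow> (\<alpha> * s + \<beta>) * deriv S s = k * S s" and s: "s \<in> I"
  shows "(\<alpha> * s + \<beta>) * deriv (deriv S) s = (k - \<alpha>) * deriv S s"
proof -
  have "((\<lambda>s. (\<alpha> * s + \<beta>) * deriv S s) has_real_derivative
      \<alpha> * deriv S s + (\<alpha> * s + \<beta>) * deriv (deriv S) s) (at s)"
    by (auto intro!: derivative_eq_intros S_derivs s)
  moreover have "((\<lambda>s. (\<alpha> * s + \<beta>) * deriv S s) has_real_derivative k * deriv S s) (at s)"
    by (rule has_field_derivative_transform_within_open[of "\<lambda>s. k * S s" _ _ I])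
      (use assms open_box in \<open>auto intro!: DERIV_cmult S_derivs\<close>)
  ultimately have "\<alpha> * deriv S s + (\<alpha> * s + \<beta>) * deriv (deriv S) s = k * deriv S s"
    by (rule DERIV_unique)
  then show ?thesis by (simp add: algebra_simps)
qed

lemma affine_admitted:
  assumes X: "\<And>p. p \<in> J \<times> I \<times> V \<Longrightarrow> X p = affine_vfield t0 t1 e0 e1 e2 e3 \<alpha> \<beta> p"
    and ode: "\<And>s. s \<in> I \<Longrightarrow> (\<alpha> * s + \<beta>) * deriv S s = k * S s"
    and e3: "e3 * ((real n + 1) * \<gamma> - real n - 3) = 0"
    and e01: "n \<ge> 1 \<Longrightarrow> e0 = 0 \<and> e1 = 0"
    and t1: "2 * t1 = (1 - \<gamma>) * \<alpha> - k + ((real n + 1) * \<gamma> - real n + 1) * e2"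
  shows "X \<in> admitted_algebra n \<gamma> S J I V"
proof -
  have "smooth_on (J \<times> I \<times> V) X"
    by (rule smooth_on_cong[OF open_box(4) _ smooth_on_affine_vfield]) (simp add: X)
  moreover have "admits n \<gamma> S J I V X"
    unfolding admits_def
  proof (intro ballI allI impI, elim conjE)
    fix t s u ut p utt uts uss :: real
    assume tsu: "t \<in> J" "s \<in> I" "u \<in> V" and p: "p > 0"
      and gas: "gas_lhs n \<gamma> S t s u ut p utt uts uss = 0"
    have fv: "fibred_vfield J I V X (\<lambda>t. t0 + t1 * t + e3 * t\<^sup>2) (\<lambda>t. t1 + 2 * e3 * t) (\<lambda>t. 2 * e3)
      (\<lambda>s. \<alpha> * s + \<beta>) (\<lambda>_. \<alpha>) (\<lambda>_. 0)
      (\<lambda>t s u. e0 + e1 * t + (e2 + e3 * t) * u) (\<lambda>t s u. e1 + e3 * u) (\<lambda>t s u. 0)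
      (\<lambda>t s u. e2 + e3 * t) (\<lambda>t s u. 0) (\<lambda>t s u. 0) (\<lambda>t s u. e3) (\<lambda>t s u. 0) (\<lambda>t s u. 0)
      (\<lambda>t s u. 0) (\<lambda>t s u. e3) (\<lambda>t s u. 0) (\<lambda>t s u. 0)"
      by (rule fibred_affine) (auto simp: X affine_vfield_def intro!: derivative_eq_intros)
    \<comment> \<open>For n >= 1 the field is linear in u > 0 and u cancels; for n = 0, where u may
      vanish, both sides are 0.\<close>
    have "real n * (1 / u * (e0 + e1 * t + (e2 + e3 * t) * u)) = real n * (e2 + e3 * t)"
      using V_pos e01 tsu(3) by (cases "n = 0") auto
    \<comment> \<open>The terms in t differ by a multiple of e3 * ((n+1) * \<gamma> - n - 3), which
      is 0.\<close>
    moreover have "2 * (t1 + 2 * e3 * t) =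
        (1 - \<gamma>) * \<alpha> - k + ((real n + 1) * \<gamma> - real n + 1) * (e2 + e3 * t)"
      using t1 e3 by algebra
    ultimately show "prolong2 X (gas_lhs n \<gamma> S) t s u ut p utt uts uss = 0"
      unfolding prolong2_fibred[OF fv tsu p gas]
      using determining_equation_holds[OF p ode[OF tsu(2)] DERIV_classifying_ode[OF ode tsu(2)],
          of "real n" "1 / u" "e0 + e1 * t + (e2 + e3 * t) * u" "e2 + e3 * t" "t1 + 2 * e3 * t" \<gamma>
            "P u * p powr (- \<gamma>)" uss]
      by (simp add: mult.assoc)
  qed
  ultimately show ?thesis by (simp add: admitted_algebra_def)
qed

lemma admitted_affine:
  assumes adm: "X \<in> admitted_algebra n \<gamma> S J I V"
  obtains t0 t1 e0 e1 e2 e3 \<alpha> \<beta> k where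
    "\<And>p. p \<in> J \<times> I \<times> V \<Longrightarrow> X p = affine_vfield t0 t1 e0 e1 e2 e3 \<alpha> \<beta> p"
    "\<And>s. s \<in> I \<Longrightarrow> (\<alpha> * s + \<beta>) * deriv S s = k * S s"
    "e3 * ((real n + 1) * \<gamma> - real n - 3) = 0" "n \<ge> 1 \<Longrightarrow> e0 = 0 \<and> e1 = 0"
    "2 * t1 = (1 - \<gamma>) * \<alpha> - k + ((real n + 1) * \<gamma> - real n + 1) * e2"
proof -
  have X: "admits n \<gamma> S J I V X" using adm by (simp add: admitted_algebra_def)
  obtain t0 s0 u0 where o: "t0 \<in> J" "s0 \<in> I" "u0 \<in> V"
    using J I V by (auto simp: open_interval_def)
  obtain T T1 T2 R R1 R2 H0 Ht Hs Hu Htt Hts Htu Hst Hss Hsu Hut Hus Huu where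
    fv0: "fibred_vfield J I V X T T1 T2 R R1 R2 H0 Ht Hs Hu Htt Hts Htu Hst Hss Hsu Hut Hus Huu"
    using admitted_fibred[OF adm] .
  define H where "H t u = H0 t s0 u" for t u
  note der = fibred_vfield.H_partials[OF fv0]
  have H0: "H0 t s u = H t u" if "t \<in> J" "s \<in> I" "u \<in> V" for t s u
    unfolding H_def
  proof (rule open_interval_constant[OF I _ that(2) o(2)])
    fix x assume x: "x \<in> I"
    show "((\<lambda>s. H0 t s u) has_real_derivative 0) (at x)"
      using der(2)[OF that(1) x that(3)] determining_equations(3)[OF fv0 X that(1) x that(3)]
      by simp
  qed
  \<comment> \<open>A second representation of the same field, with eta frozen at \<open>s0\<close>:
    all s-derivatives are now literally 0, so the conditional determining equations apply.\<close>
  have fv: "fibred_vfield J I V X T T1 T2 R R1 R2 (\<lambda>t s u. H t u) (\<lambda>t s u. Ht t s0 u) (\<lambda>t s u. 0)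
      (\<lambda>t s u. Hu t s0 u) (\<lambda>t s u. Htt t s0 u) (\<lambda>t s u. 0) (\<lambda>t s u. Htu t s0 u)
      (\<lambda>t s u. 0) (\<lambda>t s u. 0) (\<lambda>t s u. 0) (\<lambda>t s u. Hut t s0 u) (\<lambda>t s u. 0) (\<lambda>t s u. Huu t s0 u)"
  proof (rule fibred_vfield.intro)
    show "X (t, s, u) = (T t, R s, H t u)" if "t \<in> J" "s \<in> I" "u \<in> V" for t s u
      using fibred_vfield.X_eq[OF fv0 that] H0[OF that] by simp
    show "has_partials J I V (\<lambda>t s u. H t u) (\<lambda>t s u. Ht t s0 u) (\<lambda>t s u. 0) (\<lambda>t s u. Hu t s0 u)"
      "has_partials J I V (\<lambda>t s u. Ht t s0 u) (\<lambda>t s u. Htt t s0 u) (\<lambda>t s u. 0) (\<lambda>t s u. Htu t s0 u)"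
      "has_partials J I V (\<lambda>t s u. Hu t s0 u) (\<lambda>t s u. Hut t s0 u) (\<lambda>t s u. 0) (\<lambda>t s u. Huu t s0 u)"
      "has_partials J I V (\<lambda>t s u. 0) (\<lambda>t s u. 0) (\<lambda>t s u. 0) (\<lambda>t s u. 0)"
      using der o(2) by (simp_all add: has_partials_def H_def)
  qed (use open_box fibred_vfield.T1[OF fv0] fibred_vfield.T2[OF fv0] fibred_vfield.R1[OF fv0]
      fibred_vfield.R2[OF fv0] in blast)+
  note det = determining_equations[OF fv X]
  note Rder = fibred_vfield.R1[OF fv] fibred_vfield.R2[OF fv]
    and Tder = fibred_vfield.T1[OF fv] fibred_vfield.T2[OF fv]
  have R2: "R2 s = 0" if s: "s \<in> I" for s
  proof -
    \<comment> \<open>With t and u fixed, \<open>c\<close> collects the terms of the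
      \<open>uss\<close>-equation that do not vary with s, so the equation can be differentiated in
      s.\<close>
    define c where "c = real n * (1 - \<gamma>) * (1 / u0) * H t0 u0 - (\<gamma> + 1) * Hu t0 s0 u0 + 2 * T1 t0"
    have "R x * deriv S x + S x * (c - (1 - \<gamma>) * R1 x) = 0" if "x \<in> I" for x
      using det(4)[OF o(1) that o(3)] by (simp add: c_def algebra_simps)
    then have zero: "deriv (\<lambda>x. R x * deriv S x + S x * (c - (1 - \<gamma>) * R1 x)) s = 0"
      by (rule deriv_eqI_open[OF open_box(2) s _ DERIV_const])
    have "((\<lambda>x. R x * deriv S x + S x * (c - (1 - \<gamma>) * R1 x)) has_real_derivative
        R1 s * deriv S s + R s * deriv (deriv S) s + (deriv S s * (c - (1 - \<gamma>) * R1 s) -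
          S s * ((1 - \<gamma>) * R2 s))) (at s)"
      by (auto intro!: derivative_eq_intros S_derivs Rder s simp: algebra_simps)
    from trans[OF DERIV_imp_deriv[OF this, symmetric] zero]
    have E': "R1 s * deriv S s + R s * deriv (deriv S) s +
        (deriv S s * (c - (1 - \<gamma>) * R1 s) - S s * ((1 - \<gamma>) * R2 s)) = 0" .
    have "R s * deriv (deriv S) s + deriv S s * (c + \<gamma> * R1 s) + \<gamma> * S s * R2 s = 0"
      using det(6)[OF o(1) s o(3)] by (simp add: c_def algebra_simps)
    \<comment> \<open>The two identities differ by S * R2 up to sign; the terms in S', S'' and
      \<open>c\<close> cancel.\<close>
    with E' have "S s * R2 s = 0" by algebra
    then show ?thesis using S_pos[OF s] by simp
  qed
  have R1_const: "(R1 has_real_derivative 0) (at s)" if "s \<in> I" for s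
    using Rder(2)[OF that] R2[OF that] by simp
  obtain \<beta> \<alpha> where R: "\<And>s. s \<in> I \<Longrightarrow> R s = \<beta> + \<alpha> * s" "\<And>s. s \<in> I \<Longrightarrow> R1 s = \<alpha>"
    using open_interval_affine[OF I Rder(1) R1_const] by blast
  have "\<exists>e0 e1 e2 e3. \<forall>t\<in>J. \<forall>u\<in>V. H t u = e0 + e1 * t + (e2 + e3 * t) * u"
  proof (rule affine_in_each_variable[OF V, of J H])
    fix t assume t: "t \<in> J"
    have "(Hu t s0 has_real_derivative 0) (at u)" if "u \<in> V" for u
      using der(12)[OF t o(2) that] det(1)[OF t o(2) that] by simp
    from open_interval_affine[OF V der(3)[OF t o(2)] this]
    show "\<exists>a b. \<forall>u\<in>V. H t u = a + b * u" unfolding H_def by blast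
  next
    fix u assume u: "u \<in> V"
    have "((\<lambda>t. Ht t s0 u) has_real_derivative 0) (at t)" if "t \<in> J" for t
      using der(4)[OF that o(2) u] det(5)[OF that o(2) u] by simp
    from open_interval_affine[OF J der(1)[OF _ o(2) u] this]
    show "\<exists>a b. \<forall>t\<in>J. H t u = a + b * t" unfolding H_def by blast
  qed
  then obtain e0 e1 e2 e3 where H:
    "\<And>t u. t \<in> J \<Longrightarrow> u \<in> V \<Longrightarrow> H t u = e0 + e1 * t + (e2 + e3 * t) * u"
    by blast
  have X_eq: "X (t, s, u) = (T t, \<alpha> * s + \<beta>, e0 + e1 * t + (e2 + e3 * t) * u)"
    if "t \<in> J" "s \<in> I" "u \<in> V" for t s u
    using fibred_vfield.X_eq[OF fv that] R H that by simp
  \<comment> \<open>A third representation, with polynomial eta and affine R, makes the mixed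
    derivatives explicit and thereby determines T''.\<close>
  have "fibred_vfield J I V X T T1 T2 (\<lambda>s. \<alpha> * s + \<beta>) (\<lambda>_. \<alpha>) (\<lambda>_. 0)
      (\<lambda>t s u. e0 + e1 * t + (e2 + e3 * t) * u) (\<lambda>t s u. e1 + e3 * u) (\<lambda>t s u. 0)
      (\<lambda>t s u. e2 + e3 * t) (\<lambda>t s u. 0) (\<lambda>t s u. 0) (\<lambda>t s u. e3) (\<lambda>t s u. 0) (\<lambda>t s u. 0)
      (\<lambda>t s u. 0) (\<lambda>t s u. e3) (\<lambda>t s u. 0) (\<lambda>t s u. 0)"
    using X_eq Tder by (rule fibred_affine)
  note det = determining_equations[OF this X]
  have T2: "T2 t = 2 * e3" if "t \<in> J" for t
    using det(2)[OF that o(2,3)] by simp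
  have "((\<lambda>t. T t - e3 * t\<^sup>2) has_real_derivative T1 t - 2 * e3 * t) (at t)"
    "((\<lambda>t. T1 t - 2 * e3 * t) has_real_derivative 0) (at t)" if "t \<in> J" for t
    using that T2 by (auto intro!: derivative_eq_intros Tder)
  from open_interval_affine[OF J this]
  obtain t0' t1 where T: "\<And>t. t \<in> J \<Longrightarrow> T t - e3 * t\<^sup>2 = t0' + t1 * t"
    "\<And>t. t \<in> J \<Longrightarrow> T1 t - 2 * e3 * t = t1"
    by blast
  \<comment> \<open>Minus the factor of S in the \<open>uss\<close>-equation at \<open>t0\<close>,
    \<open>u0\<close>. Evaluating at \<open>s0\<close>, where S > 0, then shows that this factor is
    the same for all t and u.\<close>
  define k where "k = (1 - \<gamma>) * \<alpha> - 2 * T1 t0 + (\<gamma> + 1) * (e2 + e3 * t0) -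
    real n * (1 - \<gamma>) * (1 / u0) * (e0 + e1 * t0 + (e2 + e3 * t0) * u0)"
  have ode: "(\<alpha> * s + \<beta>) * deriv S s = k * S s" if "s \<in> I" for s
    using det(4)[OF o(1) that o(3)] by (simp add: k_def algebra_simps)
  have *: "k + real n * (1 - \<gamma>) * (1 / u) * (e0 + e1 * t + (e2 + e3 * t) * u) -
      (\<gamma> + 1) * (e2 + e3 * t) - (1 - \<gamma>) * \<alpha> + 2 * (t1 + 2 * e3 * t) = 0"
    if "t \<in> J" "u \<in> V" for t u
  proof -
    have "S s0 * (k + real n * (1 - \<gamma>) * (1 / u) * (e0 + e1 * t + (e2 + e3 * t) * u) -
      (\<gamma> + 1) * (e2 + e3 * t) - (1 - \<gamma>) * \<alpha> + 2 * (t1 + 2 * e3 * t)) = 0"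
      using det(4)[OF that(1) o(2) that(2)] ode[OF o(2)] T(2)[OF that(1)]
      by (simp add: algebra_simps)
    then show ?thesis using S_pos[OF o(2)] by simp
  qed
  obtain x y where xy: "x \<in> J" "y \<in> J" "x \<noteq> y" using open_interval_two_points[OF J] .
  have e01: "e0 = 0 \<and> e1 = 0" if n: "n \<ge> 1"
  proof -
    obtain u v where uv: "u \<in> V" "v \<in> V" "u \<noteq> v" using open_interval_two_points[OF V] .
    have pos: "u > 0" "v > 0" using uv V_pos n by auto
    have "e0 + e1 * t = 0" if "t \<in> J" for t
    proof -
      \<comment> \<open>For fixed t the relation depends on u only through (e0 + e1 * t) /
        u.\<close>
      have "real n * (1 - \<gamma>) * ((1 / u - 1 / v) * (e0 + e1 * t)) = 0"
        using *[OF that uv(1)] *[OF that uv(2)] pos by (simp add: algebra_simps)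
      moreover have "1 / u - 1 / v \<noteq> 0" using uv pos by (simp add: field_simps)
      ultimately show ?thesis using n gamma by simp
    qed
    from this[OF xy(1)] this[OF xy(2)] xy(3) show ?thesis by algebra
  qed
  have lin: "k + real n * (1 - \<gamma>) * (e2 + e3 * t) - (\<gamma> + 1) * (e2 + e3 * t) - (1 - \<gamma>) * \<alpha> +
      2 * (t1 + 2 * e3 * t) = 0" if "t \<in> J" for t
  proof -
    have "real n * (1 - \<gamma>) * (1 / u0) * (e0 + e1 * t + (e2 + e3 * t) * u0) =
        real n * (1 - \<gamma>) * (e2 + e3 * t)"
      using V_pos e01 o(3) by (cases "n = 0") auto
    with *[OF that o(3)] show ?thesis by simp
  qed
  \<comment> \<open>Up to sign, the factor multiplying x - y is the slope of \<open>lin\<close> in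
    t; this is the origin of \<gamma> = (n+3)/(n+1).\<close>
  have "(x - y) * (e3 * ((real n + 1) * \<gamma> - real n - 3)) = 0"
    using lin[OF xy(1)] lin[OF xy(2)] by algebra
  then have e3: "e3 * ((real n + 1) * \<gamma> - real n - 3) = 0" using xy(3) by simp
  show thesis
  proof (rule that[of t0' t1 e0 e1 e2 e3 \<alpha> \<beta> k])
    show "X p = affine_vfield t0' t1 e0 e1 e2 e3 \<alpha> \<beta> p" if "p \<in> J \<times> I \<times> V" for p
      using that X_eq T(1) by (auto simp: affine_vfield_def algebra_simps)
    show "2 * t1 = (1 - \<gamma>) * \<alpha> - k + ((real n + 1) * \<gamma> - real n + 1) * e2"
      using lin[OF xy(1)] e3 by algebra
  qed (use ode e3 e01 in auto)
qed

end

section \<open>Spans of generators\<close>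

text \<open>The sum in \<open>span_on\<close> runs over a set, so a Y already in G has to merge its
  coefficient with the existing one. With that case included, spans can be computed without proving
  generators distinct.\<close>

lemma span_on_insert:
  assumes "finite G"
  shows "X \<in> span_on D (insert Y G) \<longleftrightarrow> (\<exists>d. (\<lambda>p. X p - d *\<^sub>R Y p) \<in> span_on D G)"
proof
  assume "X \<in> span_on D (insert Y G)"
  then obtain c where c: "\<And>p. p \<in> D \<Longrightarrow> X p = (\<Sum>Z\<in>insert Y G. c Z *\<^sub>R Z p)"
    by (auto simp: span_on_def)
  show "\<exists>d. (\<lambda>p. X p - d *\<^sub>R Y p) \<in> span_on D G"
  proof (cases "Y \<in> G")
    case True
    then have "(\<lambda>p. X p - 0 *\<^sub>R Y p) \<in> span_on D G"
      using c by (auto simp: span_on_def insert_absorb)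
    then show ?thesis by blast
  next
    case False
    then have "(\<lambda>p. X p - c Y *\<^sub>R Y p) \<in> span_on D G"
      using c assms by (auto simp: span_on_def)
    then show ?thesis by blast
  qed
next
  assume "\<exists>d. (\<lambda>p. X p - d *\<^sub>R Y p) \<in> span_on D G"
  then obtain d c where *: "\<And>p. p \<in> D \<Longrightarrow> X p - d *\<^sub>R Y p = (\<Sum>Z\<in>G. c Z *\<^sub>R Z p)"
    by (auto simp: span_on_def)
  have X: "X p = d *\<^sub>R Y p + (\<Sum>Z\<in>G. c Z *\<^sub>R Z p)" if "p \<in> D" for p
    unfolding *[OF that, symmetric] by simp
  show "X \<in> span_on D (insert Y G)"
  proof (cases "Y \<in> G")
    case True
    have "(\<Sum>Z\<in>G. (if Z = Y then c Z + d else c Z) *\<^sub>R Z p) = d *\<^sub>R Y p + (\<Sum>Z\<in>G. c Z *\<^sub>R Z p)" for p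
      using assms True by (simp add: sum.remove[of G Y] algebra_simps)
    with X True show ?thesis
      by (auto simp: span_on_def insert_absorb intro!: exI[of _ "\<lambda>Z. if Z = Y then c Z + d else c Z"])
  next
    case False
    have "(\<Sum>Z\<in>G. (if Z = Y then d else c Z) *\<^sub>R Z p) = (\<Sum>Z\<in>G. c Z *\<^sub>R Z p)" for p
      using False by (intro sum.cong) auto
    with X False assms show ?thesis
      by (auto simp: span_on_def intro!: exI[of _ "\<lambda>Z. if Z = Y then d else c Z"])
  qed
qed

lemma span_on_insert_if:
  assumes "finite G"
  shows "X \<in> span_on D (G \<union> (if b then {Y} else {})) \<longleftrightarrow>
    (\<exists>d. (\<not> b \<longrightarrow> d = 0) \<and> (\<lambda>p. X p - d *\<^sub>R Y p) \<in> span_on D G)"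
  using span_on_insert[OF assms] by auto

lemma span_on_insert2_if:
  assumes "finite G"
  shows "X \<in> span_on D (G \<union> (if b then {Y, Z} else {})) \<longleftrightarrow>
    (\<exists>d e. (\<not> b \<longrightarrow> d = 0 \<and> e = 0) \<and> (\<lambda>p. X p - d *\<^sub>R Y p - e *\<^sub>R Z p) \<in> span_on D G)"
  using span_on_insert[OF assms] span_on_insert[of "insert Z G"] assms by auto

text \<open>The first argument of \<open>Q\<close> is what remains of twice the weight of \<open>t\<close> after subtracting the
  multiple of the common generator \<open>X\<^sub>2\<close> that accounts for the term \<open>e2 * u\<close>.\<close>

definition affine_set ::
  "(real \<times> real \<times> real) set \<Rightarrow> nat \<Rightarrow> real \<Rightarrow> (real \<Rightarrow> real \<Rightarrow> real \<Rightarrow> bool) \<Rightarrow> vfield set" where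
  "affine_set D n \<gamma> Q = {X. \<exists>t0 t1 e0 e1 e2 e3 \<alpha> \<beta>.
     Q (2 * t1 - ((real n + 1) * \<gamma> - real n + 1) * e2) \<alpha> \<beta> \<and>
     e3 * ((real n + 1) * \<gamma> - real n - 3) = 0 \<and> (n \<ge> 1 \<longrightarrow> e0 = 0 \<and> e1 = 0) \<and>
     (\<forall>p\<in>D. X p = affine_vfield t0 t1 e0 e1 e2 e3 \<alpha> \<beta> p)}"

lemma affine_set_mono:
  "(\<And>\<tau> \<alpha> \<beta>. Q \<tau> \<alpha> \<beta> \<Longrightarrow> Q' \<tau> \<alpha> \<beta>) \<Longrightarrow> affine_set D n \<gamma> Q \<subseteq> affine_set D n \<gamma> Q'"
  unfolding affine_set_def by blast

lemma finite_common_generators: "finite (common_generators n \<gamma>)"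
  by (simp add: common_generators_def)

text \<open>Peeling off the generators one by one leaves a field that must vanish on D. The
  condition \<tau> = 0 says that the weights of t and u are in the ratio of X_2.\<close>

lemma span_on_common_generators:
  "span_on D (common_generators n \<gamma>) = affine_set D n \<gamma> (\<lambda>\<tau> \<alpha> \<beta>. \<tau> = 0 \<and> \<alpha> = 0 \<and> \<beta> = 0)"
proof -
  let ?D = "(real n + 1) * \<gamma> - real n + 1"
  have e3: "e3 * ((real n + 1) * \<gamma> - real n - 3) = 0 \<longleftrightarrow>
      (\<gamma> \<noteq> (real n + 3) / (real n + 1) \<longrightarrow> e3 = 0)" for e3
  proof -
    have "(real n + 1) * \<gamma> - real n - 3 = 0 \<longleftrightarrow> \<gamma> = (real n + 3) / (real n + 1)"
      by (simp add: field_simps)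
    then show ?thesis by auto
  qed
  have empty: "X \<in> span_on D {} \<longleftrightarrow> (\<forall>p\<in>D. X p = 0)" for X
    by (simp add: span_on_def)
  let ?G = "{\<lambda>(t, s, u). (1, 0, 0), \<lambda>(t, s, u). (?D * t, 0, 2 * u)} :: vfield set"
  let ?H = "?G \<union> (if n = 0 then {\<lambda>(t, s, u). (0, 0, 1), \<lambda>(t, s, u). (0, 0, t)} else {})"
  have fin: "finite ?G" "finite ?H" by simp_all
  have comb: "X p - e3 *\<^sub>R (\<lambda>(t, s, u). (t\<^sup>2, 0, t * u)) p - e0 *\<^sub>R (\<lambda>(t, s, u). (0, 0, 1)) p -
      e1 *\<^sub>R (\<lambda>(t, s, u). (0, 0, t)) p - t0 *\<^sub>R (\<lambda>(t, s, u). (1, 0, 0)) p -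
      c *\<^sub>R (\<lambda>(t, s, u). (?D * t, 0, 2 * u)) p = 0 \<longleftrightarrow>
    X p = affine_vfield t0 (?D * c) e0 e1 (2 * c) e3 0 0 p" for X :: vfield and p t0 c e0 e1 e3
    by (cases p, cases "X p") (auto simp: affine_vfield_def zero_prod_def algebra_simps)
  define W where "W X \<longleftrightarrow> (\<exists>e3. (\<not> \<gamma> = (real n + 3) / (real n + 1) \<longrightarrow> e3 = 0) \<and>
    (\<exists>e0 e1. (\<not> n = 0 \<longrightarrow> e0 = 0 \<and> e1 = 0) \<and> (\<exists>t0 c. \<forall>p\<in>D.
      X p = affine_vfield t0 (?D * c) e0 e1 (2 * c) e3 0 0 p)))" for X :: vfield
  have "X \<in> span_on D (common_generators n \<gamma>) \<longleftrightarrow> W X" for X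
    by (simp only: common_generators_def W_def span_on_insert_if[OF fin(2)]
        span_on_insert2_if[OF fin(1)] span_on_insert finite_insert finite.emptyI empty comb)
  moreover have "W X \<longleftrightarrow> X \<in> affine_set D n \<gamma> (\<lambda>\<tau> \<alpha> \<beta>. \<tau> = 0 \<and> \<alpha> = 0 \<and> \<beta> = 0)" for X
  proof
    assume "W X"
    then obtain e0 e1 e3 t0 c where e: "\<gamma> \<noteq> (real n + 3) / (real n + 1) \<longrightarrow> e3 = 0"
      "n \<noteq> 0 \<longrightarrow> e0 = 0 \<and> e1 = 0" and
      "\<And>p. p \<in> D \<Longrightarrow> X p = affine_vfield t0 (?D * c) e0 e1 (2 * c) e3 0 0 p"
      unfolding W_def by blast
    moreover have "2 * (?D * c) - ?D * (2 * c) = 0" by simp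
    moreover have "n \<ge> 1 \<longrightarrow> e0 = 0 \<and> e1 = 0" using e(2) by simp
    ultimately show "X \<in> affine_set D n \<gamma> (\<lambda>\<tau> \<alpha> \<beta>. \<tau> = 0 \<and> \<alpha> = 0 \<and> \<beta> = 0)"
      using e(1) unfolding affine_set_def e3 by blast
  next
    assume "X \<in> affine_set D n \<gamma> (\<lambda>\<tau> \<alpha> \<beta>. \<tau> = 0 \<and> \<alpha> = 0 \<and> \<beta> = 0)"
    then obtain t0 t1 e0 e1 e2 e3 where "2 * t1 - ?D * e2 = 0"
      and e: "\<gamma> \<noteq> (real n + 3) / (real n + 1) \<longrightarrow> e3 = 0" "n \<ge> 1 \<longrightarrow> e0 = 0 \<and> e1 = 0"
      and X: "\<And>p. p \<in> D \<Longrightarrow> X p = affine_vfield t0 t1 e0 e1 e2 e3 0 0 p"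
      unfolding affine_set_def e3 by blast
    \<comment> \<open>The multiple of X_2 is e2 / 2, as its u-component is 2 * u.\<close>
    then have t1: "t1 = ?D * (e2 / 2)" by simp
    have "X p = affine_vfield t0 (?D * (e2 / 2)) e0 e1 (2 * (e2 / 2)) e3 0 0 p" if "p \<in> D" for p
      unfolding X[OF that] t1 by simp
    moreover have "n \<noteq> 0 \<longrightarrow> e0 = 0 \<and> e1 = 0" using e(2) by simp
    ultimately show "W X"
      using e(1) unfolding W_def by blast
  qed
  ultimately show ?thesis by blast
qed

text \<open>Subtracting d * Y changes t1, \<alpha>, \<beta> by a * d, b * d, c * d and leaves
  \<open>e2\<close> alone, so \<tau> changes by 2 * a * d. Adjoining a generator thus becomes a
  shift of three numbers.\<close>

lemma span_on_insert_affine: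
  assumes "finite G" and G: "span_on D G = affine_set D n \<gamma> Q"
    and Y: "\<And>t s u. Y (t, s, u) = (a * t, b * s + c, 0)"
  shows "span_on D (insert Y G) =
    affine_set D n \<gamma> (\<lambda>\<tau> \<alpha> \<beta>. \<exists>d. Q (\<tau> - 2 * a * d) (\<alpha> - b * d) (\<beta> - c * d))"
proof (intro set_eqI iffI)
  fix X
  assume "X \<in> span_on D (insert Y G)"
  then obtain d where "(\<lambda>p. X p - d *\<^sub>R Y p) \<in> affine_set D n \<gamma> Q"
    using span_on_insert[OF assms(1)] G by blast
  then obtain t0 t1 e0 e1 e2 e3 \<alpha> \<beta> where
    Q: "Q (2 * t1 - ((real n + 1) * \<gamma> - real n + 1) * e2) \<alpha> \<beta>"
    and e: "e3 * ((real n + 1) * \<gamma> - real n - 3) = 0" "n \<ge> 1 \<longrightarrow> e0 = 0 \<and> e1 = 0"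
    and X: "\<And>p. p \<in> D \<Longrightarrow> X p - d *\<^sub>R Y p = affine_vfield t0 t1 e0 e1 e2 e3 \<alpha> \<beta> p"
    unfolding affine_set_def by blast
  have "X p = affine_vfield t0 (t1 + a * d) e0 e1 e2 e3 (\<alpha> + b * d) (\<beta> + c * d) p" if "p \<in> D" for p
  proof -
    have "X p = (X p - d *\<^sub>R Y p) + d *\<^sub>R Y p" by simp
    also have "\<dots> = affine_vfield t0 (t1 + a * d) e0 e1 e2 e3 (\<alpha> + b * d) (\<beta> + c * d) p"
      unfolding X[OF that] by (cases p) (simp add: Y affine_vfield_def algebra_simps)
    finally show ?thesis .
  qed
  moreover have "Q (2 * (t1 + a * d) - ((real n + 1) * \<gamma> - real n + 1) * e2 - 2 * a * d)
      (\<alpha> + b * d - b * d) (\<beta> + c * d - c * d)"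
    using Q by (simp add: algebra_simps)
  ultimately show "X \<in> affine_set D n \<gamma> (\<lambda>\<tau> \<alpha> \<beta>. \<exists>d. Q (\<tau> - 2 * a * d) (\<alpha> - b * d) (\<beta> - c * d))"
    using e unfolding affine_set_def by blast
next
  fix X
  assume "X \<in> affine_set D n \<gamma> (\<lambda>\<tau> \<alpha> \<beta>. \<exists>d. Q (\<tau> - 2 * a * d) (\<alpha> - b * d) (\<beta> - c * d))"
  then obtain t0 t1 e0 e1 e2 e3 \<alpha> \<beta> d where
    Q: "Q (2 * t1 - ((real n + 1) * \<gamma> - real n + 1) * e2 - 2 * a * d) (\<alpha> - b * d) (\<beta> - c * d)"
    and e: "e3 * ((real n + 1) * \<gamma> - real n - 3) = 0" "n \<ge> 1 \<longrightarrow> e0 = 0 \<and> e1 = 0"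
    and X: "\<And>p. p \<in> D \<Longrightarrow> X p = affine_vfield t0 t1 e0 e1 e2 e3 \<alpha> \<beta> p"
    unfolding affine_set_def by blast
  have "X p - d *\<^sub>R Y p = affine_vfield t0 (t1 - a * d) e0 e1 e2 e3 (\<alpha> - b * d) (\<beta> - c * d) p"
    if "p \<in> D" for p
    unfolding X[OF that] by (cases p) (simp add: Y affine_vfield_def algebra_simps)
  moreover have "Q (2 * (t1 - a * d) - ((real n + 1) * \<gamma> - real n + 1) * e2) (\<alpha> - b * d) (\<beta> - c * d)"
    using Q by (simp add: algebra_simps)
  ultimately have "(\<lambda>p. X p - d *\<^sub>R Y p) \<in> affine_set D n \<gamma> Q"
    using e unfolding affine_set_def by blast
  then show "X \<in> span_on D (insert Y G)"
    using span_on_insert[OF assms(1)] G by blast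
qed

section \<open>The special forms of the entropy function\<close>

text \<open>Differentiability is not assumed: \<open>DERIV_shift\<close> is an equivalence and
  rewrites the predicate inside the choice that defines \<open>deriv\<close>.\<close>

lemma deriv_shift_fun: "deriv (shift_fun a S) s = deriv S (s + a)"
  by (simp add: deriv_def shift_fun_def DERIV_shift)

lemma open_interval_shift_set:
  assumes "open_interval I"
  shows "open_interval (shift_set a I)"
proof -
  have "shift_set a I = (\<lambda>s. s + a) -` I" by (auto simp: shift_set_def)
  then have "open (shift_set a I)"
    using assms by (auto simp: open_interval_def intro!: open_vimage continuous_intros)
  moreover obtain s where "s \<in> I" using assms by (auto simp: open_interval_def)
  then have "s - a \<in> shift_set a I" by (simp add: shift_set_def)
  moreover have "is_interval (shift_set a I)"
    using assms unfolding open_interval_def is_interval_1 shift_set_def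
    by (metis (no_types, lifting) add_right_mono mem_Collect_eq)
  ultimately show ?thesis by (auto simp: open_interval_def)
qed

lemma smooth_on_shift_fun: "open I \<Longrightarrow> smooth_on I S \<Longrightarrow> smooth_on (shift_set a I) (shift_fun a S)"
  using smooth_on_translate[of I S a] by (simp add: shift_set_def shift_fun_def vimage_def)

lemma classifying_odeI:
  "(\<alpha>, \<beta>) \<noteq> (0, 0) \<Longrightarrow> (\<And>s. s \<in> I \<Longrightarrow> (\<alpha> * s + \<beta>) * deriv S s = q * S s) \<Longrightarrow>
    classifying_ode I S"
  unfolding classifying_ode_def by blast

lemma constant_form_deriv:
  assumes "open I" "constant_form I S" "s \<in> I"
  shows "deriv S s = 0"
  using assms by (auto simp: constant_form_def intro!: deriv_eqI_open[OF _ _ _ DERIV_const])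

lemma exp_form_deriv:
  assumes "open I" "exp_form I S q" "s \<in> I"
  shows "deriv S s = q * S s"
proof -
  obtain A0 where S: "\<And>s. s \<in> I \<Longrightarrow> S s = A0 * exp (q * s)"
    using assms(2) by (auto simp: exp_form_def)
  have "deriv S s = q * (A0 * exp (q * s))"
    by (rule deriv_eqI_open[OF assms(1,3) S]) (auto intro!: derivative_eq_intros)
  then show ?thesis by (simp add: S assms(3))
qed

lemma DERIV_abs_powr:
  fixes s q :: real
  assumes "s \<noteq> 0"
  shows "((\<lambda>s. \<bar>s\<bar> powr q) has_real_derivative q * \<bar>s\<bar> powr q / s) (at s)"
proof (cases "s > 0")
  case True
  then have "((\<lambda>s. s powr q) has_real_derivative q * \<bar>s\<bar> powr q / s) (at s)"
    by (auto intro!: derivative_eq_intros simp: powr_diff)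
  then show ?thesis
    by (rule has_field_derivative_transform_within_open[where S = "{0<..}"]) (use True in auto)
next
  case False
  with assms have "s < 0" by simp
  then have "((\<lambda>s. (- s) powr q) has_real_derivative q * \<bar>s\<bar> powr q / s) (at s)"
    by (auto intro!: derivative_eq_intros simp: powr_diff)
  then show ?thesis
    by (rule has_field_derivative_transform_within_open[where S = "{..<0}"]) (use \<open>s < 0\<close> in auto)
qed

lemma power_form_deriv:
  assumes "open I" "power_form I S q" "s \<in> I"
  shows "s \<noteq> 0" "s * deriv S s = q * S s"
proof -
  obtain A0 where S: "\<And>s. s \<in> I \<Longrightarrow> S s = A0 * \<bar>s\<bar> powr q"
    using assms(2) by (auto simp: power_form_def)
  show s: "s \<noteq> 0" using assms(2,3) by (auto simp: power_form_def)
  have "deriv S s = A0 * (q * \<bar>s\<bar> powr q / s)"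
    by (rule deriv_eqI_open[OF assms(1,3) S DERIV_cmult[OF DERIV_abs_powr[OF s]]])
  with S[OF assms(3)] s show "s * deriv S s = q * S s" by simp
qed

text \<open>One witness serves every interval: 1 + s^2 is positive everywhere, and the equation
  becomes the polynomial identity (2*\<alpha> - q) * s^2 + 2*\<beta> * s - q = 0, which three points
  refute.\<close>

lemma exists_not_classifying_ode:
  assumes "open_interval I"
  shows "\<exists>S. smooth_on I S \<and> (\<forall>s\<in>I. S s > 0) \<and> \<not> classifying_ode I S"
proof (intro exI conjI ballI)
  show "smooth_on I (\<lambda>s::real. 1 + s\<^sup>2)"
    using real_polynomial_function_power[OF real_polynomial_function.intros(1)[OF bounded_linear_ident], of 2]
    by (intro polynomial_function_smooth_on polynomial_function_add polynomial_function_const)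
      (simp add: real_polynomial_function_eq)
  show "1 + s\<^sup>2 > 0" for s :: real
    by (simp add: add_pos_nonneg)
  have d: "deriv (\<lambda>s::real. 1 + s\<^sup>2) s = 2 * s" for s
    by (rule DERIV_imp_deriv) (auto intro!: derivative_eq_intros)
  obtain x where "x \<in> I" using assms by (auto simp: open_interval_def)
  then obtain e where x: "e > 0" "ball x e \<subseteq> I"
    using assms by (auto simp: open_interval_def open_contains_ball)
  define h where "h = e / 2"
  have h: "h > 0" "x \<in> I" "x + h \<in> I" "x - h \<in> I"
    using x by (auto simp: h_def dist_real_def subset_eq)
  show "\<not> classifying_ode I (\<lambda>s. 1 + s\<^sup>2)"
  proof
    assume "classifying_ode I (\<lambda>s. 1 + s\<^sup>2)"
    then obtain \<alpha> \<beta> q where ab: "(\<alpha>, \<beta>) \<noteq> (0, 0)"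
      and eq: "\<And>s. s \<in> I \<Longrightarrow> (\<alpha> * s + \<beta>) * (2 * s) = q * (1 + s\<^sup>2)"
      unfolding classifying_ode_def d by blast
    note 1 = eq[OF h(2)] and 2 = eq[OF h(3)] and 3 = eq[OF h(4)]
    \<comment> \<open>The second difference over x - h, x, x + h isolates the quadratic
      coefficient.\<close>
    have "h\<^sup>2 * (2 * \<alpha> - q) = 0" using 1 2 3 by algebra
    then have q: "q = 2 * \<alpha>" using h(1) by simp
    have "h * \<beta> = 0" using 1 2 unfolding q by algebra
    then have \<beta>: "\<beta> = 0" using h(1) by simp
    have "\<alpha> = 0" using 1 unfolding q \<beta> by algebra
    with \<beta> ab show False by simp
  qed
qed

section \<open>Integrating the classifying equation\<close>

context gas_dynamics
begin

lemma shifted: "gas_dynamics n \<gamma> (shift_fun a S) J (shift_set a I) V"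
  using gamma J V V_pos open_interval_shift_set[OF I] smooth_on_shift_fun[OF open_box(2) S_smooth] S_pos
  by unfold_locales (auto simp: shift_set_def shift_fun_def)

lemma classifying_ode_if_special_form:
  assumes "constant_form (shift_set a I) (shift_fun a S) \<or>
    power_form (shift_set a I) (shift_fun a S) q \<or> exp_form (shift_set a I) (shift_fun a S) q"
  shows "classifying_ode I S"
proof -
  have "open (shift_set a I)"
    using open_interval_shift_set[OF I] by (simp add: open_interval_def)
  note forms = constant_form_deriv[OF this] power_form_deriv[OF this] exp_form_deriv[OF this]
  have mem: "s - a \<in> shift_set a I" if "s \<in> I" for s
    using that by (simp add: shift_set_def)
  from assms show ?thesis
  proof (elim disjE)
    assume "constant_form (shift_set a I) (shift_fun a S)"
    from forms(1)[OF this mem, unfolded deriv_shift_fun]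
    have "(0 * s + 1) * deriv S s = 0 * S s" if "s \<in> I" for s
      using that by simp
    then show ?thesis by (rule classifying_odeI[rotated]) simp_all
  next
    assume "power_form (shift_set a I) (shift_fun a S) q"
    from forms(3)[OF this mem, unfolded deriv_shift_fun]
    have "(1 * s + (- a)) * deriv S s = q * S s" if "s \<in> I" for s
      using that by (simp add: shift_fun_def)
    then show ?thesis by (rule classifying_odeI[rotated]) simp_all
  next
    assume "exp_form (shift_set a I) (shift_fun a S) q"
    from forms(4)[OF this mem, unfolded deriv_shift_fun]
    have "(0 * s + 1) * deriv S s = q * S s" if "s \<in> I" for s
      using that by (simp add: shift_fun_def)
    then show ?thesis by (rule classifying_odeI[rotated]) simp_all
  qed
qed

lemma constant_form_if_deriv_zero:
  assumes "\<And>s. s \<in> I \<Longrightarrow> deriv S s = 0"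
  shows "constant_form I S"
proof -
  have "(S has_real_derivative 0) (at s)" if "s \<in> I" for s
    using S_derivs(1)[OF that] assms[OF that] by simp
  from open_interval_constant[OF I this] show ?thesis
    unfolding constant_form_def by (cases "I = {}") blast+
qed

lemma exp_form_if_deriv:
  assumes "\<And>s. s \<in> I \<Longrightarrow> deriv S s = q * S s"
  shows "exp_form I S q"
proof -
  obtain s0 where s0: "s0 \<in> I" using I by (auto simp: open_interval_def)
  have deriv: "((\<lambda>s. S s * exp (- q * s)) has_real_derivative 0) (at s)" if "s \<in> I" for s
    using assms[OF that] by (auto intro!: derivative_eq_intros S_derivs(1)[OF that])
  have const: "S s * exp (- q * s) = S s0 * exp (- q * s0)" if "s \<in> I" for s
    using open_interval_constant[OF I deriv that s0] by blast
  have "S s = (S s0 * exp (- q * s0)) * exp (q * s)" if "s \<in> I" for s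
    unfolding const[OF that, symmetric] by (simp add: mult.assoc flip: exp_add)
  then show ?thesis unfolding exp_form_def by blast
qed

text \<open>At s = 0 the equation would force q * S = 0, so the interval I misses 0 and lies on one
  side of it. There \<open>\<bar>s\<bar> powr (- q)\<close> is an integrating factor.\<close>

lemma power_form_if_deriv:
  assumes eq: "\<And>s. s \<in> I \<Longrightarrow> s * deriv S s = q * S s" and "q \<noteq> 0"
  shows "power_form I S q"
proof -
  obtain s0 where s0: "s0 \<in> I" using I by (auto simp: open_interval_def)
  have ne: "s \<noteq> 0" if "s \<in> I" for s
    using eq[OF that] S_pos[OF that] \<open>q \<noteq> 0\<close> by auto
  have sign: "I \<subseteq> {0<..} \<or> I \<subseteq> {..<0}"
  proof (rule ccontr)
    assume "\<not> (I \<subseteq> {0<..} \<or> I \<subseteq> {..<0})"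
    then obtain x y where "x \<in> I" "\<not> 0 < x" "y \<in> I" "\<not> y < 0" by blast
    then have "0 \<in> I" using I unfolding not_less open_interval_def is_interval_1 by blast
    with ne show False by blast
  qed
  have deriv: "((\<lambda>s. S s * \<bar>s\<bar> powr (- q)) has_real_derivative 0) (at s)" if "s \<in> I" for s
  proof -
    have "((\<lambda>s. S s * \<bar>s\<bar> powr (- q)) has_real_derivative
        deriv S s * \<bar>s\<bar> powr (- q) + (- q * \<bar>s\<bar> powr (- q) / s) * S s) (at s)"
      by (intro DERIV_mult S_derivs(1)[OF that] DERIV_abs_powr ne[OF that])
    moreover have "deriv S s = q * S s / s"
      using eq[OF that] ne[OF that] by (simp add: field_simps)
    ultimately show ?thesis by simp
  qed
  have const: "S s * \<bar>s\<bar> powr (- q) = S s0 * \<bar>s0\<bar> powr (- q)" if "s \<in> I" for s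
    using open_interval_constant[OF I deriv that s0] by blast
  have "S s = (S s0 * \<bar>s0\<bar> powr (- q)) * \<bar>s\<bar> powr q" if "s \<in> I" for s
    unfolding const[OF that, symmetric]
    using ne[OF that] by (simp add: mult.assoc flip: powr_add)
  with sign show ?thesis unfolding power_form_def by blast
qed

lemma special_form_if_classifying_ode:
  assumes "classifying_ode I S"
  shows "\<exists>a. constant_form (shift_set a I) (shift_fun a S)
    \<or> (\<exists>q. q \<noteq> 0 \<and> power_form (shift_set a I) (shift_fun a S) q)
    \<or> (\<exists>q. q \<noteq> 0 \<and> exp_form (shift_set a I) (shift_fun a S) q)"
proof -
  obtain \<alpha> \<beta> q where ab: "(\<alpha>, \<beta>) \<noteq> (0, 0)"
    and ode: "\<And>s. s \<in> I \<Longrightarrow> (\<alpha> * s + \<beta>) * deriv S s = q * S s"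
    using assms unfolding classifying_ode_def by blast
  have shift_0: "shift_set 0 I = I" "shift_fun 0 S = S"
    by (auto simp: shift_set_def shift_fun_def)
  show ?thesis
  proof (cases "q = 0")
    case True
    \<comment> \<open>At a zero of \<alpha> * s + \<beta> the differentiated equation with q = 0
      reads 0 = - \<alpha> * S'.\<close>
    have "deriv S s = 0" if "s \<in> I" for s
    proof (cases "\<alpha> * s + \<beta> = 0")
      case True
      then have "\<alpha> \<noteq> 0" using ab by auto
      with DERIV_classifying_ode[OF ode that] True \<open>q = 0\<close> show ?thesis by simp
    qed (use ode[OF that] \<open>q = 0\<close> in simp)
    from constant_form_if_deriv_zero[OF this] show ?thesis
      by (intro exI[of _ 0]) (simp add: shift_0)
  next
    case q: False
    show ?thesis
    proof (cases "\<alpha> = 0")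
      case True
      then have "\<beta> \<noteq> 0" using ab by simp
      then have "exp_form I S (q / \<beta>)"
        using exp_form_if_deriv[of "q / \<beta>"] ode True by (simp add: field_simps)
      with q \<open>\<beta> \<noteq> 0\<close> have "\<exists>q. q \<noteq> 0 \<and> exp_form I S q"
        by (intro exI[of _ "q / \<beta>"]) simp
      then show ?thesis by (intro exI[of _ 0]) (simp add: shift_0)
    next
      case False
      \<comment> \<open>This translation moves the zero of \<alpha> * s + \<beta> to the
        origin.\<close>
      define a where "a = - \<beta> / \<alpha>"
      interpret shifted: gas_dynamics n \<gamma> "shift_fun a S" J "shift_set a I" V
        by (rule shifted)
      have "s * deriv (shift_fun a S) s = q / \<alpha> * shift_fun a S s" if "s \<in> shift_set a I" for s
      proof -
        have eq: "\<alpha> * (s + a) + \<beta> = \<alpha> * s"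
          using False by (simp add: a_def algebra_simps)
        have "\<alpha> * s * deriv S (s + a) = q * S (s + a)"
          using ode[of "s + a"] that unfolding eq by (simp add: shift_set_def)
        then show ?thesis
          using False unfolding deriv_shift_fun by (simp add: shift_fun_def field_simps)
      qed
      then have "power_form (shift_set a I) (shift_fun a S) (q / \<alpha>)"
        using q False by (intro shifted.power_form_if_deriv) auto
      moreover have "q / \<alpha> \<noteq> 0" using q False by simp
      ultimately show ?thesis by blast
    qed
  qed
qed

section \<open>The classification\<close>

text \<open>The span of each list of generators is also an \<open>affine_set\<close>, so every case
  below reduces to the equivalence of two conditions on \<tau>, \<alpha> and \<beta>.\<close>

lemma admitted_algebra_eq_affine_set:
  "admitted_algebra n \<gamma> S J I V = affine_set (J \<times> I \<times> V) n \<gamma>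
    (\<lambda>\<tau> \<alpha> \<beta>. \<exists>k. (\<forall>s\<in>I. (\<alpha> * s + \<beta>) * deriv S s = k * S s) \<and> \<tau> = (1 - \<gamma>) * \<alpha> - k)"
proof (intro set_eqI iffI)
  fix X
  assume "X \<in> admitted_algebra n \<gamma> S J I V"
  then obtain t0 t1 e0 e1 e2 e3 \<alpha> \<beta> k where
    "\<And>p. p \<in> J \<times> I \<times> V \<Longrightarrow> X p = affine_vfield t0 t1 e0 e1 e2 e3 \<alpha> \<beta> p"
    "\<And>s. s \<in> I \<Longrightarrow> (\<alpha> * s + \<beta>) * deriv S s = k * S s"
    "e3 * ((real n + 1) * \<gamma> - real n - 3) = 0" "n \<ge> 1 \<Longrightarrow> e0 = 0 \<and> e1 = 0"
    and "2 * t1 = (1 - \<gamma>) * \<alpha> - k + ((real n + 1) * \<gamma> - real n + 1) * e2"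
    using admitted_affine by blast
  moreover from this(5) have
    "2 * t1 - ((real n + 1) * \<gamma> - real n + 1) * e2 = (1 - \<gamma>) * \<alpha> - k" by simp
  ultimately show "X \<in> affine_set (J \<times> I \<times> V) n \<gamma>
    (\<lambda>\<tau> \<alpha> \<beta>. \<exists>k. (\<forall>s\<in>I. (\<alpha> * s + \<beta>) * deriv S s = k * S s) \<and> \<tau> = (1 - \<gamma>) * \<alpha> - k)"
    unfolding affine_set_def by blast
next
  fix X
  assume "X \<in> affine_set (J \<times> I \<times> V) n \<gamma>
    (\<lambda>\<tau> \<alpha> \<beta>. \<exists>k. (\<forall>s\<in>I. (\<alpha> * s + \<beta>) * deriv S s = k * S s) \<and> \<tau> = (1 - \<gamma>) * \<alpha> - k)"
  then obtain t0 t1 e0 e1 e2 e3 \<alpha> \<beta> k where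
    *: "\<And>p. p \<in> J \<times> I \<times> V \<Longrightarrow> X p = affine_vfield t0 t1 e0 e1 e2 e3 \<alpha> \<beta> p"
    "\<And>s. s \<in> I \<Longrightarrow> (\<alpha> * s + \<beta>) * deriv S s = k * S s"
    "e3 * ((real n + 1) * \<gamma> - real n - 3) = 0" "n \<ge> 1 \<Longrightarrow> e0 = 0 \<and> e1 = 0"
    and "2 * t1 - ((real n + 1) * \<gamma> - real n + 1) * e2 = (1 - \<gamma>) * \<alpha> - k"
    unfolding affine_set_def by blast
  then have "2 * t1 = (1 - \<gamma>) * \<alpha> - k + ((real n + 1) * \<gamma> - real n + 1) * e2" by simp
  with * show "X \<in> admitted_algebra n \<gamma> S J I V" by (rule affine_admitted)
qed

text \<open>In the explicit form of the fields a translation by a only replaces \<beta> by \<alpha>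
  * a + \<beta>, and the classifying equation moves along with it.\<close>

lemma shift_vfield_admitted:
  assumes "X \<in> admitted_algebra n \<gamma> S J I V"
  shows "shift_vfield a X \<in> admitted_algebra n \<gamma> (shift_fun a S) J (shift_set a I) V"
proof -
  obtain t0 t1 e0 e1 e2 e3 \<alpha> \<beta> k where
    X: "\<And>p. p \<in> J \<times> I \<times> V \<Longrightarrow> X p = affine_vfield t0 t1 e0 e1 e2 e3 \<alpha> \<beta> p"
    and ode: "\<And>s. s \<in> I \<Longrightarrow> (\<alpha> * s + \<beta>) * deriv S s = k * S s"
    and e: "e3 * ((real n + 1) * \<gamma> - real n - 3) = 0" "n \<ge> 1 \<Longrightarrow> e0 = 0 \<and> e1 = 0"
      "2 * t1 = (1 - \<gamma>) * \<alpha> - k + ((real n + 1) * \<gamma> - real n + 1) * e2"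
    using admitted_affine[OF assms] by blast
  interpret shifted: gas_dynamics n \<gamma> "shift_fun a S" J "shift_set a I" V
    by (rule shifted)
  show ?thesis
  proof (rule shifted.affine_admitted[OF _ _ e])
    show "shift_vfield a X p = affine_vfield t0 t1 e0 e1 e2 e3 \<alpha> (\<alpha> * a + \<beta>) p"
      if "p \<in> J \<times> shift_set a I \<times> V" for p
      using that X by (auto simp: shift_vfield_def shift_set_def affine_vfield_def algebra_simps)
    show "(\<alpha> * s + (\<alpha> * a + \<beta>)) * deriv (shift_fun a S) s = k * shift_fun a S s"
      if "s \<in> shift_set a I" for s
      using ode[of "s + a"] that unfolding deriv_shift_fun
      by (simp add: shift_fun_def shift_set_def algebra_simps)
  qed
qed

lemma shift_vfield_admitted_iff:
  "X \<in> admitted_algebra n \<gamma> S J I V \<longleftrightarrow>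
    shift_vfield a X \<in> admitted_algebra n \<gamma> (shift_fun a S) J (shift_set a I) V"
proof
  interpret shifted: gas_dynamics n \<gamma> "shift_fun a S" J "shift_set a I" V
    by (rule shifted)
  assume "shift_vfield a X \<in> admitted_algebra n \<gamma> (shift_fun a S) J (shift_set a I) V"
  from shifted.shift_vfield_admitted[OF this, of "- a"]
  show "X \<in> admitted_algebra n \<gamma> S J I V"
    by (simp add: shift_vfield_def shift_fun_def shift_set_def case_prod_unfold)
qed (rule shift_vfield_admitted)

lemma generic_algebra:
  assumes "\<not> classifying_ode I S"
  shows "admitted_algebra n \<gamma> S J I V = span_on (J \<times> I \<times> V) (common_generators n \<gamma>)"
proof -
  obtain s0 where s0: "s0 \<in> I" using I by (auto simp: open_interval_def)
  have "(\<exists>k. (\<forall>s\<in>I. (\<alpha> * s + \<beta>) * deriv S s = k * S s) \<and> \<tau> = (1 - \<gamma>) * \<alpha> - k) \<longleftrightarrow>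
      \<tau> = 0 \<and> \<alpha> = 0 \<and> \<beta> = 0" for \<tau> \<alpha> \<beta>
  proof
    assume "\<exists>k. (\<forall>s\<in>I. (\<alpha> * s + \<beta>) * deriv S s = k * S s) \<and> \<tau> = (1 - \<gamma>) * \<alpha> - k"
    then obtain k where k: "\<And>s. s \<in> I \<Longrightarrow> (\<alpha> * s + \<beta>) * deriv S s = k * S s"
      and \<tau>: "\<tau> = (1 - \<gamma>) * \<alpha> - k" by blast
    then have ab: "\<alpha> = 0" "\<beta> = 0"
      using assms unfolding classifying_ode_def by blast+
    then have "k = 0" using k[OF s0] S_pos[OF s0] by simp
    with ab \<tau> show "\<tau> = 0 \<and> \<alpha> = 0 \<and> \<beta> = 0" by simp
  qed auto
  then show ?thesis
    by (simp add: admitted_algebra_eq_affine_set span_on_common_generators)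
qed

lemma common_generators_admitted: "common_generators n \<gamma> \<subseteq> admitted_algebra n \<gamma> S J I V"
proof
  fix X
  assume X: "X \<in> common_generators n \<gamma>"
  \<comment> \<open>X is once itself plus the zero combination, so no case distinction over the
    generators arises.\<close>
  have "X \<in> span_on (J \<times> I \<times> V) (insert X (common_generators n \<gamma>))"
    using span_on_insert[OF finite_common_generators, of X "J \<times> I \<times> V" X n \<gamma>]
    by (auto simp: span_on_def intro!: exI[of _ 1] exI[of _ "\<lambda>_. 0"])
  with X have "X \<in> affine_set (J \<times> I \<times> V) n \<gamma> (\<lambda>\<tau> \<alpha> \<beta>. \<tau> = 0 \<and> \<alpha> = 0 \<and> \<beta> = 0)"
    by (simp add: insert_absorb span_on_common_generators)
  also have "\<dots> \<subseteq> admitted_algebra n \<gamma> S J I V"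
    unfolding admitted_algebra_eq_affine_set by (rule affine_set_mono) auto
  finally show "X \<in> admitted_algebra n \<gamma> S J I V" .
qed

lemma constant_algebra:
  assumes "constant_form I S"
  shows "admitted_algebra n \<gamma> S J I V = span_on (J \<times> I \<times> V) (common_generators n \<gamma> \<union>
    {\<lambda>(t, s, u). (0, 1, 0), \<lambda>(t, s, u). ((\<gamma> - 1) * t, - 2 * s, 0)})"
proof -
  obtain s0 where s0: "s0 \<in> I" using I by (auto simp: open_interval_def)
  have "(\<exists>k. (\<forall>s\<in>I. (\<alpha> * s + \<beta>) * deriv S s = k * S s) \<and> \<tau> = (1 - \<gamma>) * \<alpha> - k) \<longleftrightarrow>
      \<tau> = (1 - \<gamma>) * \<alpha>" for \<tau> \<alpha> \<beta>
    using constant_form_deriv[OF open_box(2) assms] S_pos s0 by force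
  moreover have "(\<exists>d d'. \<tau> - 2 * 0 * d - 2 * (\<gamma> - 1) * d' = 0 \<and> \<alpha> - 0 * d - (- 2) * d' = 0 \<and>
      \<beta> - 1 * d - 0 * d' = 0) \<longleftrightarrow> \<tau> = (1 - \<gamma>) * \<alpha>" for \<tau> \<alpha> \<beta>
    \<comment> \<open>The dilation contributes -2 * d' to \<alpha>, so d' = -\<alpha> / 2; the
      translation absorbs \<beta>.\<close>
    by (auto intro!: exI[of _ "- \<alpha> / 2"] simp: algebra_simps) algebra
  moreover have "common_generators n \<gamma> \<union>
      {\<lambda>(t, s, u). (0, 1, 0), \<lambda>(t, s, u). ((\<gamma> - 1) * t, - 2 * s, 0)} =
    insert (\<lambda>(t, s, u). (0, 1, 0)) (insert (\<lambda>(t, s, u). ((\<gamma> - 1) * t, - 2 * s, 0))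
      (common_generators n \<gamma>))"
    by auto
  moreover have "span_on (J \<times> I \<times> V) (insert (\<lambda>(t, s, u). ((\<gamma> - 1) * t, - 2 * s, 0))
      (common_generators n \<gamma>)) = affine_set (J \<times> I \<times> V) n \<gamma>
      (\<lambda>\<tau> \<alpha> \<beta>. \<exists>d'. \<tau> - 2 * (\<gamma> - 1) * d' = 0 \<and> \<alpha> - (- 2) * d' = 0 \<and> \<beta> - 0 * d' = 0)"
    by (rule span_on_insert_affine[OF finite_common_generators span_on_common_generators]) simp
  then have "span_on (J \<times> I \<times> V) (insert (\<lambda>(t, s, u). (0, 1, 0))
      (insert (\<lambda>(t, s, u). ((\<gamma> - 1) * t, - 2 * s, 0)) (common_generators n \<gamma>))) =
      affine_set (J \<times> I \<times> V) n \<gamma> (\<lambda>\<tau> \<alpha> \<beta>. \<exists>d d'. \<tau> - 2 * 0 * d - 2 * (\<gamma> - 1) * d' = 0 \<and>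
        \<alpha> - 0 * d - (- 2) * d' = 0 \<and> \<beta> - 1 * d - 0 * d' = 0)"
    by (rule span_on_insert_affine[rotated]) (simp_all add: finite_common_generators)
  ultimately show ?thesis
    by (simp only: admitted_algebra_eq_affine_set)
qed

text \<open>With a single extra generator the admissible triples (\<tau>, \<alpha>, \<beta>) must
  form the line spanned by (2*a, b, c).\<close>

lemma extended_algebra:
  assumes Y: "\<And>t s u. Y (t, s, u) = (a * t, b * s + c, 0)"
    and Q: "\<And>\<tau> \<alpha> \<beta>. (\<exists>k. (\<forall>s\<in>I. (\<alpha> * s + \<beta>) * deriv S s = k * S s) \<and> \<tau> = (1 - \<gamma>) * \<alpha> - k) \<longleftrightarrow>
      (\<exists>d. \<tau> = 2 * a * d \<and> \<alpha> = b * d \<and> \<beta> = c * d)"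
  shows "admitted_algebra n \<gamma> S J I V = span_on (J \<times> I \<times> V) (common_generators n \<gamma> \<union> {Y})"
  using span_on_insert_affine[OF finite_common_generators span_on_common_generators Y,
      of "J \<times> I \<times> V" n \<gamma>]
  by (simp add: admitted_algebra_eq_affine_set Q)

lemma power_algebra:
  assumes "power_form I S q" "q \<noteq> 0"
  shows "admitted_algebra n \<gamma> S J I V = span_on (J \<times> I \<times> V) (common_generators n \<gamma> \<union>
    {\<lambda>(t, s, u). ((1 - \<gamma> - q) * t, 2 * s, 0)})"
proof (rule extended_algebra)
  note ode = power_form_deriv[OF open_box(2) assms(1)]
  obtain x y where xy: "x \<in> I" "y \<in> I" "x \<noteq> y" using open_interval_two_points[OF I] .
  show "(\<exists>k. (\<forall>s\<in>I. (\<alpha> * s + \<beta>) * deriv S s = k * S s) \<and> \<tau> = (1 - \<gamma>) * \<alpha> - k) \<longleftrightarrow>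
      (\<exists>d. \<tau> = 2 * (1 - \<gamma> - q) * d \<and> \<alpha> = 2 * d \<and> \<beta> = 0 * d)" for \<tau> \<alpha> \<beta>
  proof
    assume "\<exists>k. (\<forall>s\<in>I. (\<alpha> * s + \<beta>) * deriv S s = k * S s) \<and> \<tau> = (1 - \<gamma>) * \<alpha> - k"
    then obtain k where k: "\<And>s. s \<in> I \<Longrightarrow> (\<alpha> * s + \<beta>) * deriv S s = k * S s"
      and \<tau>: "\<tau> = (1 - \<gamma>) * \<alpha> - k" by blast
    \<comment> \<open>Both equations give S'; eliminating it and dividing by S leaves an identity
      affine in s, which two points of I decide.\<close>
    have lin: "(\<alpha> * s + \<beta>) * q = k * s" if "s \<in> I" for s
    proof -
      have "S s * ((\<alpha> * s + \<beta>) * q) = S s * (k * s)"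
        using k[OF that] ode(2)[OF that] by algebra
      then show ?thesis using S_pos[OF that] by simp
    qed
    have "(x - y) * (\<alpha> * q - k) = 0"
      using lin[OF xy(1)] lin[OF xy(2)] by algebra
    then have k: "k = \<alpha> * q" using xy(3) by simp
    then have "\<beta> = 0" using lin[OF xy(1)] assms(2) by (simp add: algebra_simps)
    then show "\<exists>d. \<tau> = 2 * (1 - \<gamma> - q) * d \<and> \<alpha> = 2 * d \<and> \<beta> = 0 * d"
      using \<tau> k by (intro exI[of _ "\<alpha> / 2"]) (simp add: algebra_simps)
  next
    assume "\<exists>d. \<tau> = 2 * (1 - \<gamma> - q) * d \<and> \<alpha> = 2 * d \<and> \<beta> = 0 * d"
    then show "\<exists>k. (\<forall>s\<in>I. (\<alpha> * s + \<beta>) * deriv S s = k * S s) \<and> \<tau> = (1 - \<gamma>) * \<alpha> - k"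
      using ode(2) by (intro exI[of _ "\<alpha> * q"]) (auto simp: algebra_simps)
  qed
qed auto

lemma exp_algebra:
  assumes "exp_form I S q" "q \<noteq> 0"
  shows "admitted_algebra n \<gamma> S J I V = span_on (J \<times> I \<times> V) (common_generators n \<gamma> \<union>
    {\<lambda>(t, s, u). (q * t, - 2, 0)})"
proof (rule extended_algebra)
  note ode = exp_form_deriv[OF open_box(2) assms(1)]
  obtain x y where xy: "x \<in> I" "y \<in> I" "x \<noteq> y" using open_interval_two_points[OF I] .
  show "(\<exists>k. (\<forall>s\<in>I. (\<alpha> * s + \<beta>) * deriv S s = k * S s) \<and> \<tau> = (1 - \<gamma>) * \<alpha> - k) \<longleftrightarrow>
      (\<exists>d. \<tau> = 2 * q * d \<and> \<alpha> = 0 * d \<and> \<beta> = - 2 * d)" for \<tau> \<alpha> \<beta>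
  proof
    assume "\<exists>k. (\<forall>s\<in>I. (\<alpha> * s + \<beta>) * deriv S s = k * S s) \<and> \<tau> = (1 - \<gamma>) * \<alpha> - k"
    then obtain k where k: "\<And>s. s \<in> I \<Longrightarrow> (\<alpha> * s + \<beta>) * deriv S s = k * S s"
      and \<tau>: "\<tau> = (1 - \<gamma>) * \<alpha> - k" by blast
    have lin: "(\<alpha> * s + \<beta>) * q = k" if "s \<in> I" for s
      using k[OF that] ode[OF that] S_pos[OF that] by (simp add: mult.assoc[symmetric])
    have "(\<alpha> * x + \<beta>) * q - (\<alpha> * y + \<beta>) * q = 0"
      by (simp add: lin xy)
    then have "(x - y) * q * \<alpha> = 0" by (simp add: algebra_simps)
    then have \<alpha>: "\<alpha> = 0" using xy(3) assms(2) by simp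
    then have "k = \<beta> * q" using lin[OF xy(1)] by simp
    then show "\<exists>d. \<tau> = 2 * q * d \<and> \<alpha> = 0 * d \<and> \<beta> = - 2 * d"
      using \<tau> \<alpha> by (intro exI[of _ "- \<beta> / 2"]) simp
  next
    assume "\<exists>d. \<tau> = 2 * q * d \<and> \<alpha> = 0 * d \<and> \<beta> = - 2 * d"
    then show "\<exists>k. (\<forall>s\<in>I. (\<alpha> * s + \<beta>) * deriv S s = k * S s) \<and> \<tau> = (1 - \<gamma>) * \<alpha> - k"
      using ode by (intro exI[of _ "\<beta> * q"]) auto
  qed
qed auto

end

text \<open>The conjunct producing S' keeps the generic case from being vacuous on any interval. The
  conjunct on \<open>shift_vfield\<close> transfers the three normal forms, which are stated without
  a shift, to every translate of S.\<close>

theorem mainTheorem2: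
  fixes n :: nat and \<gamma> :: real and S :: "real \<Rightarrow> real" and J I V :: "real set"
  assumes "n \<in> {0, 1, 2}" and "\<gamma> > 1"
    and "open_interval J" and "open_interval I" and "open_interval V"
    and "n \<ge> 1 \<Longrightarrow> V \<subseteq> {0<..}"
    and "smooth_on I S" and "\<And>s. s \<in> I \<Longrightarrow> S s > 0"
  shows
    "common_generators n \<gamma> \<subseteq> admitted_algebra n \<gamma> S J I V
   \<and> (\<not> classifying_ode I S \<longrightarrow>
        admitted_algebra n \<gamma> S J I V = span_on (J \<times> I \<times> V) (common_generators n \<gamma>))
   \<and> (\<exists>S'. smooth_on I S' \<and> (\<forall>s\<in>I. S' s > 0) \<and> \<not> classifying_ode I S')
   \<and> (span_on (J \<times> I \<times> V) (common_generators n \<gamma>) \<subset> admitted_algebra n \<gamma> S J I V \<longrightarrow>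
        classifying_ode I S)
   \<and> (classifying_ode I S \<longleftrightarrow>
        (\<exists>a. constant_form (shift_set a I) (shift_fun a S)
           \<or> (\<exists>q. q \<noteq> 0 \<and> power_form (shift_set a I) (shift_fun a S) q)
           \<or> (\<exists>q. q \<noteq> 0 \<and> exp_form (shift_set a I) (shift_fun a S) q)))
   \<and> (\<forall>a X. X \<in> admitted_algebra n \<gamma> S J I V \<longleftrightarrow>
        shift_vfield a X \<in> admitted_algebra n \<gamma> (shift_fun a S) J (shift_set a I) V)
   \<and> (constant_form I S \<longrightarrow>
        admitted_algebra n \<gamma> S J I V =
        span_on (J \<times> I \<times> V) (common_generators n \<gamma> \<union>
          {\<lambda>(t, s, u). (0, 1, 0), \<lambda>(t, s, u). ((\<gamma> - 1) * t, - 2 * s, 0)}))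
   \<and> (\<forall>q. q \<noteq> 0 \<and> power_form I S q \<longrightarrow>
        admitted_algebra n \<gamma> S J I V =
        span_on (J \<times> I \<times> V) (common_generators n \<gamma> \<union>
          {\<lambda>(t, s, u). ((1 - \<gamma> - q) * t, 2 * s, 0)}))
   \<and> (\<forall>q. q \<noteq> 0 \<and> exp_form I S q \<longrightarrow>
        admitted_algebra n \<gamma> S J I V =
        span_on (J \<times> I \<times> V) (common_generators n \<gamma> \<union>
          {\<lambda>(t, s, u). (q * t, - 2, 0)}))"
proof -
  interpret gas_dynamics n \<gamma> S J I V
    using assms by unfold_locales auto
  have "classifying_ode I S \<longleftrightarrow>
      (\<exists>a. constant_form (shift_set a I) (shift_fun a S)
         \<or> (\<exists>q. q \<noteq> 0 \<and> power_form (shift_set a I) (shift_fun a S) q)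
         \<or> (\<exists>q. q \<noteq> 0 \<and> exp_form (shift_set a I) (shift_fun a S) q))"
    using special_form_if_classifying_ode classifying_ode_if_special_form by blast
  moreover have "span_on (J \<times> I \<times> V) (common_generators n \<gamma>) \<subset> admitted_algebra n \<gamma> S J I V \<longrightarrow>
      classifying_ode I S"
    using generic_algebra by blast
  ultimately show ?thesis
    using common_generators_admitted generic_algebra exists_not_classifying_ode[OF I]
      shift_vfield_admitted_iff constant_algebra power_algebra exp_algebra
    by (intro conjI allI impI) (blast | simp)+
qed

end
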